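(* Let $n\in\{3,4\}$ and let $X$ be a finite premaniplex of rank $n$. Then there exists a finite maniplex $M$ of rank $n$ whose symmetry type graph $\mathrm{STG}(M)=M/\mathrm{Aut}(M)$ is isomorphic to $X$ (as a premaniplex, i.e. by a colour-preserving graph isomorphism).
   Context: Graphs: a graph is a $4$-tuple $(\mathrm D,\mathrm V;\mathrm{beg},\mathrm{inv})$ where $\mathrm D$ is a set of darts, $\mathrm V$ a non-empty set of vertices, $\mathrm{beg}:\mathrm D\to \mathrm V$ assigns to each dart its tail, and $\mathrm{inv}:\mathrm D\to\mathrm D$, $x\mapsto x^{-1}$, is an involution (possibly with fixed points). An edge is a pair $\{x,x^{-1}\}$; it is a semiedge if $x=x^{-1}$. The valency of a vertex is the number of darts with that tail. Multiple (parallel) edges are allowed. A graph is simple if it has no semiedges, no loops and no parallel edges. Homomorphisms, isomorphisms and automorphisms are maps on vertices and darts commuting with $\mathrm{beg}$ and $\mathrm{inv}$. Premaniplex of rank $n$: a connected graph whose edges and semiedges are coloured with colours $0,1,\dots,n-1$ so that every vertex is the tail of exactly one dart of each colour (the two darts of an edge having the colour of that edge; in particular there are no loops), and such that for all $i,j$ with $|i-j|\ge 2$ every walk of length $4$ whose colours alternate between $i$ and $j$ is closed. Maniplex of rank $n$: a connected simple $n$-valent graph whose edges are properly coloured with the colours $0,1,\dots,n-1$ and in which the edges of colours $i$ and $j$ form alternating $4$-cycles whenever $|i-j|\ge2$. Equivalently, a premaniplex of rank $n$ with no semiedges and no parallel edges. Automorphisms and isomorphisms of (pre)maniplexes are colour-preserving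 graph automorphisms and isomorphisms; $\mathrm{Aut}(M)$ is the group of all automorphisms of $M$. Quotient and symmetry type graph: for $G\le \mathrm{Aut}(M)$, $M/G$ is the coloured graph whose vertices and darts are the $G$-orbits of vertices and darts of $M$, with the induced maps $\mathrm{beg}$ and $\mathrm{inv}$ and the induced colours (so an edge of $M$ whose two darts lie in the same $G$-orbit becomes a semiedge). The symmetry type graph of $M$ is $\mathrm{STG}(M)=M/\mathrm{Aut}(M)$, which is a premaniplex of rank $n$. *)

theory Defs
  imports "HOL-Algebra.Group_Action"
begin

subsection \<open>Graphs with darts and semiedges\<close>

record ('d, 'v) graph =
  darts :: "'d set"
  verts :: "'v set"
  beg :: "'d \<Rightarrow> 'v"
  dinv :: "'d \<Rightarrow> 'd"

definition graph :: "('d, 'v, 'x) graph_scheme \<Rightarrow> bool" where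
  "graph X \<longleftrightarrow> verts X \<noteq> {} \<and> beg X \<in> darts X \<rightarrow> verts X \<and> dinv X \<in> darts X \<rightarrow> darts X
     \<and> (\<forall>x\<in>darts X. dinv X (dinv X x) = x)"

definition finite_graph :: "('d, 'v, 'x) graph_scheme \<Rightarrow> bool" where
  "finite_graph X \<longleftrightarrow> finite (verts X) \<and> finite (darts X)"

definition edge_of :: "('d, 'v, 'x) graph_scheme \<Rightarrow> 'd \<Rightarrow> 'd set" where
  "edge_of X x = {x, dinv X x}"

definition endpoints :: "('d, 'v, 'x) graph_scheme \<Rightarrow> 'd \<Rightarrow> 'v set" where
  "endpoints X x = {beg X x, beg X (dinv X x)}"

definition has_semiedges :: "('d, 'v, 'x) graph_scheme \<Rightarrow> bool" where
  "has_semiedges X \<longleftrightarrow> (\<exists>x\<in>darts X. dinv X x = x)"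

definition has_loops :: "('d, 'v, 'x) graph_scheme \<Rightarrow> bool" where
  "has_loops X \<longleftrightarrow> (\<exists>x\<in>darts X. dinv X x \<noteq> x \<and> beg X (dinv X x) = beg X x)"

definition has_parallel_edges :: "('d, 'v, 'x) graph_scheme \<Rightarrow> bool" where
  "has_parallel_edges X \<longleftrightarrow> (\<exists>x\<in>darts X. \<exists>y\<in>darts X. dinv X x \<noteq> x \<and> dinv X y \<noteq> y
     \<and> edge_of X x \<noteq> edge_of X y \<and> endpoints X x = endpoints X y)"

definition simple_graph :: "('d, 'v, 'x) graph_scheme \<Rightarrow> bool" where
  "simple_graph X \<longleftrightarrow> graph X \<and> \<not> has_semiedges X \<and> \<not> has_loops X \<and> \<not> has_parallel_edges X"

definition valency :: "('d, 'v, 'x) graph_scheme \<Rightarrow> 'v \<Rightarrow> nat" where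
  "valency X v = card {x \<in> darts X. beg X x = v}"

fun walk :: "('d, 'v, 'x) graph_scheme \<Rightarrow> 'v \<Rightarrow> 'd list \<Rightarrow> 'v \<Rightarrow> bool" where
  "walk X u [] v \<longleftrightarrow> u \<in> verts X \<and> u = v"
| "walk X u (x # xs) v \<longleftrightarrow> x \<in> darts X \<and> beg X x = u \<and> walk X (beg X (dinv X x)) xs v"

definition connected_graph :: "('d, 'v, 'x) graph_scheme \<Rightarrow> bool" where
  "connected_graph X \<longleftrightarrow> graph X \<and> (\<forall>u\<in>verts X. \<forall>v\<in>verts X. \<exists>xs. walk X u xs v)"


subsection \<open>Edge-coloured graphs, premaniplexes and maniplexes\<close>

record ('d, 'v) cgraph = "('d, 'v) graph" +
  colour :: "'d \<Rightarrow> nat"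

definition edge_colouring :: "nat \<Rightarrow> ('d, 'v, 'x) cgraph_scheme \<Rightarrow> bool" where
  "edge_colouring n X \<longleftrightarrow>
     (\<forall>x\<in>darts X. colour X x < n \<and> colour X (dinv X x) = colour X x)"

definition far_colours :: "nat \<Rightarrow> nat \<Rightarrow> nat \<Rightarrow> bool" where
  "far_colours n i j \<longleftrightarrow> i < n \<and> j < n \<and> \<bar>int i - int j\<bar> \<ge> 2"

definition premaniplex :: "nat \<Rightarrow> ('d, 'v, 'x) cgraph_scheme \<Rightarrow> bool" where
  "premaniplex n X \<longleftrightarrow> connected_graph X \<and> edge_colouring n X
     \<and> (\<forall>v\<in>verts X. \<forall>i<n. \<exists>!x. x \<in> darts X \<and> beg X x = v \<and> colour X x = i)
     \<and> (\<forall>i j u v xs. far_colours n i j \<and> walk X u xs v \<and> map (colour X) xs = [i, j, i, j]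
          \<longrightarrow> u = v)"

definition proper_edge_colouring :: "nat \<Rightarrow> ('d, 'v, 'x) cgraph_scheme \<Rightarrow> bool" where
  "proper_edge_colouring n X \<longleftrightarrow> edge_colouring n X
     \<and> (\<forall>x\<in>darts X. \<forall>y\<in>darts X. beg X x = beg X y \<and> x \<noteq> y \<longrightarrow> colour X x \<noteq> colour X y)"

text \<open>A vertex of an \<open>n\<close>-valent graph properly coloured with \<open>n\<close> colours is on exactly one edge of
  each colour, so the edges of colours \<open>i\<close> and \<open>j\<close> form alternating 4-cycles iff each vertex is on
  such a cycle.\<close>

definition maniplex :: "nat \<Rightarrow> ('d, 'v, 'x) cgraph_scheme \<Rightarrow> bool" where
  "maniplex n M \<longleftrightarrow> connected_graph M \<and> simple_graph M
     \<and> (\<forall>v\<in>verts M. valency M v = n) \<and> proper_edge_colouring n M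
     \<and> (\<forall>i j. far_colours n i j \<longrightarrow> (\<forall>v\<in>verts M. \<exists>xs. walk M v xs v
          \<and> map (colour M) xs = [i, j, i, j] \<and> distinct (map (beg M) xs)))"


subsection \<open>Isomorphisms and automorphisms\<close>

definition cgraph_hom ::
  "('d, 'v, 'x) cgraph_scheme \<Rightarrow> ('e, 'w, 'y) cgraph_scheme \<Rightarrow> (('v \<Rightarrow> 'w) \<times> ('d \<Rightarrow> 'e)) set" where
  "cgraph_hom X Y = {(f, h). f \<in> verts X \<rightarrow> verts Y \<and> h \<in> darts X \<rightarrow> darts Y
     \<and> (\<forall>x\<in>darts X. beg Y (h x) = f (beg X x) \<and> dinv Y (h x) = h (dinv X x)
          \<and> colour Y (h x) = colour X x)}"

definition cgraph_iso ::
  "('d, 'v, 'x) cgraph_scheme \<Rightarrow> ('e, 'w, 'y) cgraph_scheme \<Rightarrow> (('v \<Rightarrow> 'w) \<times> ('d \<Rightarrow> 'e)) set" where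
  "cgraph_iso X Y = {(f, h) \<in> cgraph_hom X Y.
     bij_betw f (verts X) (verts Y) \<and> bij_betw h (darts X) (darts Y)}"

definition isomorphic_cgraphs ::
  "('d, 'v, 'x) cgraph_scheme \<Rightarrow> ('e, 'w, 'y) cgraph_scheme \<Rightarrow> bool" where
  "isomorphic_cgraphs X Y \<longleftrightarrow> cgraph_iso X Y \<noteq> {}"

text \<open>As in \<^const>\<open>BijGroup\<close>, the two components are extensional functions, so that each
  automorphism is represented once.\<close>

definition Aut :: "('d, 'v, 'x) cgraph_scheme \<Rightarrow> (('v \<Rightarrow> 'v) \<times> ('d \<Rightarrow> 'd)) monoid" where
  "Aut X = (BijGroup (verts X) \<times>\<times> BijGroup (darts X))
     \<lparr>carrier := (Bij (verts X) \<times> Bij (darts X)) \<inter> cgraph_iso X X\<rparr>"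


subsection \<open>Quotients and symmetry type graphs\<close>

text \<open>For a subgroup \<open>G\<close> of \<^term>\<open>Aut X\<close> the maps \<^term>\<open>beg X\<close> and \<^term>\<open>dinv X\<close> are
  \<open>G\<close>-equivariant, hence map orbits onto orbits; colours are constant on orbits.\<close>

definition quotient_cgraph ::
  "('d, 'v, 'x) cgraph_scheme \<Rightarrow> (('v \<Rightarrow> 'v) \<times> ('d \<Rightarrow> 'd), 'y) monoid_scheme
     \<Rightarrow> ('d set, 'v set) cgraph" where
  "quotient_cgraph X G =
     \<lparr>darts = orbits G (darts X) snd,
      verts = orbits G (verts X) fst,
      beg = (\<lambda>S. beg X ` S),
      dinv = (\<lambda>S. dinv X ` S),
      colour = (\<lambda>S. the_elem (colour X ` S))\<rparr>"

definition STG :: "('d, 'v, 'x) cgraph_scheme \<Rightarrow> ('d set, 'v set) cgraph" where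
  "STG M = quotient_cgraph M (Aut M)"


subsection \<open>Consistency of the definitions\<close>

lemma carrier_Aut:
  "carrier (Aut X) = (Bij (verts X) \<times> Bij (darts X)) \<inter> cgraph_iso X X"
  by (simp add: Aut_def)

lemma compose_in_iso:
  assumes "(f, h) \<in> cgraph_iso X X" "(f', h') \<in> cgraph_iso X X" "graph X"
  shows "(compose (verts X) f f', compose (darts X) h h') \<in> cgraph_iso X X"
proof -
  have "bij_betw (compose (verts X) f f') (verts X) (verts X)"
    "bij_betw (compose (darts X) h h') (darts X) (darts X)"
    using assms by (auto simp: cgraph_iso_def intro!: bij_betw_compose)
  then show ?thesis
    using assms by (auto simp: cgraph_iso_def cgraph_hom_def graph_def compose_def Pi_iff)
qed

lemma inv_in_iso:
  assumes iso: "(f, h) \<in> cgraph_iso X X" and X: "graph X"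
  shows "(\<lambda>v\<in>verts X. inv_into (verts X) f v, \<lambda>x\<in>darts X. inv_into (darts X) h x) \<in> cgraph_iso X X"
proof -
  have f: "bij_betw f (verts X) (verts X)" and h: "bij_betw h (darts X) (darts X)"
    using iso by (auto simp: cgraph_iso_def)
  let ?f = "\<lambda>v\<in>verts X. inv_into (verts X) f v" and ?h = "\<lambda>x\<in>darts X. inv_into (darts X) h x"
  have f': "bij_betw ?f (verts X) (verts X)" and h': "bij_betw ?h (darts X) (darts X)"
    using bij_betw_inv_into[OF f] bij_betw_inv_into[OF h] by simp_all
  have "beg X (?h x) = ?f (beg X x) \<and> dinv X (?h x) = ?h (dinv X x) \<and> colour X (?h x) = colour X x"
    if x: "x \<in> darts X" for x
  proof -
    obtain y where y: "y \<in> darts X" "x = h y"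
      using h x by (auto simp: bij_betw_def)
    have hy: "beg X x = f (beg X y)" "dinv X x = h (dinv X y)" "colour X x = colour X y"
      using iso y by (auto simp: cgraph_iso_def cgraph_hom_def)
    have "beg X y \<in> verts X" "dinv X y \<in> darts X" "beg X x \<in> verts X" "dinv X x \<in> darts X"
      using X y x by (auto simp: graph_def)
    then show ?thesis
      using f h x y hy by (auto simp: bij_betw_def inv_into_f_f)
  qed
  then show ?thesis
    using f' h' by (auto simp: cgraph_iso_def cgraph_hom_def dest: bij_betwE)
qed

lemma id_in_Aut:
  assumes "graph X"
  shows "(\<lambda>v\<in>verts X. v, \<lambda>x\<in>darts X. x) \<in> carrier (Aut X)"
  using assms
  by (auto simp: carrier_Aut id_Bij cgraph_iso_def cgraph_hom_def graph_def Pi_iff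
      bij_betw_def inj_on_def)

lemma subgroup_Aut:
  assumes X: "graph X"
  shows "subgroup (carrier (Aut X)) (BijGroup (verts X) \<times>\<times> BijGroup (darts X))"
proof -
  let ?P = "BijGroup (verts X) \<times>\<times> BijGroup (darts X)"
  have P: "group ?P"
    by (intro DirProd_group group_BijGroup)
  show ?thesis
  proof (rule group.subgroupI[OF P])
    show "carrier (Aut X) \<subseteq> carrier ?P"
      by (auto simp: carrier_Aut BijGroup_def)
    show "carrier (Aut X) \<noteq> {}"
      using id_in_Aut[OF X] by auto
    fix a assume a: "a \<in> carrier (Aut X)"
    then show "inv\<^bsub>?P\<^esub> a \<in> carrier (Aut X)"
      using inv_in_iso[OF _ X, of "fst a" "snd a"]
      by (cases a) (auto simp: carrier_Aut inv_DirProd group_BijGroup inv_BijGroup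
          BijGroup_def[THEN arg_cong, of carrier] restrict_inv_into_Bij)
    fix b assume "b \<in> carrier (Aut X)"
    with a show "a \<otimes>\<^bsub>?P\<^esub> b \<in> carrier (Aut X)"
      using compose_in_iso[OF _ _ X, of "fst a" "snd a" "fst b" "snd b"]
      by (cases a; cases b) (auto simp: carrier_Aut BijGroup_def compose_Bij)
  qed
qed

lemma group_Aut:
  assumes "graph X"
  shows "group (Aut X)"
  using subgroup.subgroup_is_group[OF subgroup_Aut[OF assms] DirProd_group[OF group_BijGroup group_BijGroup]]
  by (simp add: Aut_def)

text \<open>The quotient by a group of automorphisms has the induced maps and colours.\<close>

lemma quotient_cgraph_induced:
  assumes "carrier G \<subseteq> carrier (Aut X)" "carrier G \<noteq> {}" "x \<in> darts X"
  shows "beg (quotient_cgraph X G) (orbit G snd x) = orbit G fst (beg X x)"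
    and "dinv (quotient_cgraph X G) (orbit G snd x) = orbit G snd (dinv X x)"
    and "colour (quotient_cgraph X G) (orbit G snd x) = colour X x"
proof -
  have orb: "orbit G fst y = (\<lambda>g. fst g y) ` carrier G"
    "orbit G snd x = (\<lambda>g. snd g x) ` carrier G" for x y
    unfolding orbit_def by blast+
  have eq: "beg X (snd g x) = fst g (beg X x)" "dinv X (snd g x) = snd g (dinv X x)"
    "colour X (snd g x) = colour X x" if "g \<in> carrier G" for g
    using assms(1,3) that by (force simp: carrier_Aut cgraph_iso_def cgraph_hom_def)+
  show "beg (quotient_cgraph X G) (orbit G snd x) = orbit G fst (beg X x)"
    by (simp add: quotient_cgraph_def orb image_image eq cong: image_cong)
  show "dinv (quotient_cgraph X G) (orbit G snd x) = orbit G snd (dinv X x)"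
    by (simp add: quotient_cgraph_def orb image_image eq cong: image_cong)
  have "colour X ` orbit G snd x = {colour X x}"
    using assms(2) by (auto simp: orb image_image eq cong: image_cong)
  then show "colour (quotient_cgraph X G) (orbit G snd x) = colour X x"
    by (simp add: quotient_cgraph_def)
qed

lemma premaniplex_no_loops:
  assumes "premaniplex n X"
  shows "\<not> has_loops X"
proof
  assume "has_loops X"
  then obtain x where x: "x \<in> darts X" "dinv X x \<noteq> x" "beg X (dinv X x) = beg X x"
    by (auto simp: has_loops_def)
  then have "dinv X x \<in> darts X" "beg X x \<in> verts X" "colour X x < n"
    "colour X (dinv X x) = colour X x"
    using assms by (auto simp: premaniplex_def connected_graph_def graph_def edge_colouring_def)
  then show False
    using assms x unfolding premaniplex_def by metis
qed

lemma maniplexD_cycles: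
  assumes "maniplex n M" and far: "far_colours n i j"
  shows "\<forall>v\<in>verts M. \<exists>xs. walk M v xs v \<and> map (colour M) xs = [i, j, i, j]
        \<and> distinct (map (beg M) xs)"
proof -
  have "\<forall>i j. far_colours n i j \<longrightarrow> (\<forall>v\<in>verts M. \<exists>xs. walk M v xs v
          \<and> map (colour M) xs = [i, j, i, j] \<and> distinct (map (beg M) xs))"
    using assms(1) unfolding maniplex_def by (elim conjE)
  from this[rule_format, OF far] show ?thesis
    by (intro ballI)
qed

lemma maniplex_imp_premaniplex:
  assumes "maniplex n M"
  shows "premaniplex n M \<and> \<not> has_semiedges M \<and> \<not> has_parallel_edges M"
proof -
  have M: "connected_graph M" "simple_graph M" "proper_edge_colouring n M" "edge_colouring n M" "graph M"
    using assms by (auto simp: maniplex_def proper_edge_colouring_def simple_graph_def)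
  have uniq: "x = y" if "x \<in> darts M" "y \<in> darts M" "beg M x = beg M y" "colour M x = colour M y" for x y
    using M(3) that by (auto simp: proper_edge_colouring_def)
  have ex: "\<exists>!x. x \<in> darts M \<and> beg M x = v \<and> colour M x = i" if v: "v \<in> verts M" and i: "i < n" for v i
  proof -
    let ?D = "{x \<in> darts M. beg M x = v}"
    have "inj_on (colour M) ?D"
      using uniq by (auto simp: inj_on_def)
    moreover have "card ?D = n"
      using assms v by (auto simp: maniplex_def valency_def)
    ultimately have "card (colour M ` ?D) = card {..<n}"
      by (simp add: card_image)
    moreover have "colour M ` ?D \<subseteq> {..<n}"
      using M(4) by (auto simp: edge_colouring_def)
    ultimately have "colour M ` ?D = {..<n}"
      by (intro card_subset_eq) auto
    then have "i \<in> colour M ` ?D"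
      using i by simp
    then obtain x where "x \<in> darts M" "beg M x = v" "colour M x = i"
      by blast
    then show ?thesis
      by (intro ex1I[of _ x]) (auto intro: uniq)
  qed
  have same: "xs = ys \<and> v = w" if "walk M u xs v" "walk M u ys w" "map (colour M) xs = map (colour M) ys"
    for u v w xs ys
    using that
  proof (induction xs arbitrary: u ys)
    case Nil
    then show ?case by simp
  next
    case (Cons x xs)
    then obtain y ys' where ys: "ys = y # ys'"
      by (cases ys) auto
    have "x = y"
      using Cons.prems ys by (auto intro: uniq)
    then show ?case
      using Cons.IH[of _ ys'] Cons.prems ys by auto
  qed
  have "u = v" if far: "far_colours n i j" and "walk M u xs v" "map (colour M) xs = [i, j, i, j]" for i j u v xs
  proof -
    have "u \<in> verts M"
      using that M(5) by (cases xs) (auto simp: graph_def)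
    moreover have "\<forall>v\<in>verts M. \<exists>xs. walk M v xs v \<and> map (colour M) xs = [i, j, i, j]
        \<and> distinct (map (beg M) xs)"
      using maniplexD_cycles[OF assms far] .
    ultimately obtain ys where "walk M u ys u" "map (colour M) ys = [i, j, i, j]"
      by metis
    then show ?thesis
      using same that by (metis (no_types))
  qed
  then have "premaniplex n M"
    unfolding premaniplex_def using M(1,4) ex by metis
  then show ?thesis
    using M(2) by (simp add: simple_graph_def)
qed

lemma premaniplex_imp_maniplex:
  assumes pre: "premaniplex n M" and nosemi: "\<not> has_semiedges M" and nopar: "\<not> has_parallel_edges M"
  shows "maniplex n M"
proof -
  have M: "connected_graph M" "graph M" "edge_colouring n M"
    using pre by (auto simp: premaniplex_def connected_graph_def)
  have g: "beg M x \<in> verts M" "dinv M x \<in> darts M" "dinv M (dinv M x) = x" "dinv M x \<noteq> x"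
      "colour M x < n" "colour M (dinv M x) = colour M x" "beg M (dinv M x) \<noteq> beg M x"
    if "x \<in> darts M" for x
    using that M nosemi premaniplex_no_loops[OF pre]
    by (auto simp: graph_def has_semiedges_def edge_colouring_def has_loops_def)
  have ex: "\<exists>!x. x \<in> darts M \<and> beg M x = v \<and> colour M x = i" if "v \<in> verts M" "i < n" for v i
    using pre that by (auto simp: premaniplex_def)
  have uniq: "x = y" if "x \<in> darts M" "y \<in> darts M" "beg M x = beg M y" "colour M x = colour M y" for x y
    using ex[of "beg M x" "colour M x"] that g by metis
  have val: "valency M v = n" if v: "v \<in> verts M" for v
  proof -
    let ?D = "{x \<in> darts M. beg M x = v}"
    have "bij_betw (colour M) ?D {..<n}"
      unfolding bij_betw_def
    proof
      show "inj_on (colour M) ?D"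
        using uniq by (auto simp: inj_on_def)
      show "colour M ` ?D = {..<n}"
        using g(5) ex[OF v] by (force simp: image_iff)
    qed
    then show ?thesis
      by (auto simp: valency_def dest: bij_betw_same_card)
  qed
  have par: False if "x \<in> darts M" "y \<in> darts M" "colour M x \<noteq> colour M y"
    "endpoints M x = endpoints M y" for x y
  proof -
    have "edge_of M x \<noteq> edge_of M y"
      using that g by (metis edge_of_def insertE insertI1 singletonD)
    then show False
      using that nopar g(4) unfolding has_parallel_edges_def by blast
  qed
  have cyc: "\<exists>xs. walk M v xs v \<and> map (colour M) xs = [i, j, i, j] \<and> distinct (map (beg M) xs)"
    if ij: "far_colours n i j" and v: "v \<in> verts M" for i j v
  proof -
    have lt: "i < n" "j < n" "i \<noteq> j"
      using ij by (auto simp: far_colours_def)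
    obtain a where a: "a \<in> darts M" "beg M a = v" "colour M a = i"
      using ex[OF v lt(1)] by blast
    obtain b where b: "b \<in> darts M" "beg M b = beg M (dinv M a)" "colour M b = j"
      using ex[OF g(1)[OF g(2)[OF a(1)]] lt(2)] by blast
    obtain c where c: "c \<in> darts M" "beg M c = beg M (dinv M b)" "colour M c = i"
      using ex[OF g(1)[OF g(2)[OF b(1)]] lt(1)] by blast
    obtain d where d: "d \<in> darts M" "beg M d = beg M (dinv M c)" "colour M d = j"
      using ex[OF g(1)[OF g(2)[OF c(1)]] lt(2)] by blast
    have w: "walk M v [a, b, c, d] (beg M (dinv M d))"
      using a b c d g by simp
    then have closed: "v = beg M (dinv M d)"
      using pre ij a b c d unfolding premaniplex_def
      by (metis list.simps(8) list.simps(9))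
    have "beg M c \<noteq> beg M a"
      using par[OF a(1) b(1)] a b c lt by (auto simp: endpoints_def insert_commute)
    moreover have "beg M d \<noteq> beg M b"
      using par[OF b(1) c(1)] b c d lt by (auto simp: endpoints_def insert_commute)
    moreover have "beg M a \<noteq> beg M b" "beg M b \<noteq> beg M c" "beg M c \<noteq> beg M d" "beg M d \<noteq> beg M a"
      using g(7)[OF a(1)] g(7)[OF b(1)] g(7)[OF c(1)] g(7)[OF d(1)] a b c d closed by auto
    ultimately show ?thesis
      using w closed a b c d by (intro exI[of _ "[a, b, c, d]"]) auto
  qed
  have "simple_graph M"
    using M nosemi nopar premaniplex_no_loops[OF pre] by (simp add: simple_graph_def)
  moreover have "proper_edge_colouring n M"
    using M uniq by (auto simp: proper_edge_colouring_def)
  ultimately show ?thesis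
    unfolding maniplex_def by (intro conjI allI impI ballI M(1) val cyc)
qed

theorem maniplex_iff:
  "maniplex n M \<longleftrightarrow> premaniplex n M \<and> \<not> has_semiedges M \<and> \<not> has_parallel_edges M"
  using maniplex_imp_premaniplex premaniplex_imp_maniplex by blast

lemma group_action_Aut:
  assumes "graph X"
  shows "group_action (Aut X) (verts X) fst" "group_action (Aut X) (darts X) snd"
proof -
  have "fst \<in> hom (Aut X) (BijGroup (verts X))" "snd \<in> hom (Aut X) (BijGroup (darts X))"
    by (auto simp: hom_def Aut_def BijGroup_def)
  then show "group_action (Aut X) (verts X) fst" "group_action (Aut X) (darts X) snd"
    using group_Aut[OF assms] group_BijGroup
    by (auto simp: group_action_def group_hom_def group_hom_axioms_def)
qed

lemma (in group_action) orbit_eqI: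
  assumes x: "x \<in> E" and y: "y \<in> orbit G \<phi> x"
  shows "orbit G \<phi> y = orbit G \<phi> x"
proof -
  have sub: "orbit G \<phi> z \<subseteq> E" if "z \<in> E" for z
    unfolding orbit_def using element_image[OF _ that] by auto
  have yE: "y \<in> E"
    using sub[OF x] y by auto
  have le: "orbit G \<phi> b \<subseteq> orbit G \<phi> a" if "a \<in> E" "b \<in> E" "b \<in> orbit G \<phi> a" for a b
    using sub[OF that(2)] orbit_trans[OF that(1,2) _ that(3)] by (meson subset_iff)
  show ?thesis
    using le[OF x yE y] le[OF yE x orbit_sym[OF x yE y]] by (rule subset_antisym)
qed

theorem premaniplex_STG:
  assumes X: "premaniplex n X"
  shows "premaniplex n (STG X)"
proof -
  let ?ov = "orbit (Aut X) fst" and ?od = "orbit (Aut X) snd" and ?Q = "STG X"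
  have con: "connected_graph X" "graph X" "edge_colouring n X"
    using X by (auto simp: premaniplex_def connected_graph_def)
  have g: "beg X x \<in> verts X" "dinv X x \<in> darts X" "dinv X (dinv X x) = x"
      "colour X x < n" "colour X (dinv X x) = colour X x" if "x \<in> darts X" for x
    using that con by (auto simp: graph_def edge_colouring_def)
  have ex: "\<exists>!x. x \<in> darts X \<and> beg X x = v \<and> colour X x = i" if "v \<in> verts X" "i < n" for v i
    using X that by (auto simp: premaniplex_def)
  have uniq: "x = y" if "x \<in> darts X" "y \<in> darts X" "beg X x = beg X y" "colour X x = colour X y" for x y
    using ex[of "beg X x" "colour X x"] that g by metis
  interpret V: group_action "Aut X" "verts X" fst by (rule group_action_Aut[OF con(2)])
  interpret D: group_action "Aut X" "darts X" snd by (rule group_action_Aut[OF con(2)])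
  have dV: "verts ?Q = ?ov ` verts X" and dD: "darts ?Q = ?od ` darts X"
    by (auto simp: STG_def quotient_cgraph_def orbits_def)
  have ind: "beg ?Q (?od x) = ?ov (beg X x)" "dinv ?Q (?od x) = ?od (dinv X x)"
    "colour ?Q (?od x) = colour X x" if "x \<in> darts X" for x
    unfolding STG_def using quotient_cgraph_induced[OF order_refl _ that] id_in_Aut[OF con(2)]
    by blast+
  have aut: "beg X (snd a x) = fst a (beg X x)" "colour X (snd a x) = colour X x" "snd a x \<in> darts X"
    if "a \<in> carrier (Aut X)" "x \<in> darts X" for a x
    using that by (force simp: carrier_Aut cgraph_iso_def cgraph_hom_def)+
  have lift1: "\<exists>x\<in>darts X. d = ?od x \<and> beg X x = v"
    if d: "d \<in> darts ?Q" "beg ?Q d = ?ov v" and v: "v \<in> verts X" for d v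
  proof -
    obtain y where y: "y \<in> darts X" "d = ?od y"
      using d dD by auto
    then have "v \<in> ?ov (beg X y)"
      using d ind(1) V.element_image[OF _ v] V.orbit_refl[OF v] by metis
    then obtain a where a: "a \<in> carrier (Aut X)" "v = fst a (beg X y)"
      by (auto simp: orbit_def)
    then have "snd a y \<in> ?od y"
      unfolding orbit_def by (intro CollectI exI[of _ a] conjI refl)
    then have "?od (snd a y) = ?od y"
      using D.orbit_eqI y(1) by metis
    then show ?thesis
      using a y aut by metis
  qed
  have lift: "\<exists>xs w'. walk X v xs w' \<and> ds = map ?od xs \<and> w = ?ov w' \<and> set xs \<subseteq> darts X"
    if "walk ?Q (?ov v) ds w" "v \<in> verts X" for v ds w
    using that
  proof (induction ds arbitrary: v)
    case Nil
    then show ?case by (intro exI[of _ "[]"]) auto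
  next
    case (Cons d ds)
    then obtain x where x: "x \<in> darts X" "d = ?od x" "beg X x = v"
      using lift1[of d v] by auto
    then obtain xs w' where "walk X (beg X (dinv X x)) xs w'" "ds = map ?od xs" "w = ?ov w'"
      "set xs \<subseteq> darts X"
      using Cons.IH[of "beg X (dinv X x)"] Cons.prems ind g by auto
    then show ?case
      using x by (intro exI[of _ "x # xs"] exI[of _ w']) auto
  qed
  have proj: "walk ?Q (?ov u) (map ?od xs) (?ov v)" if "walk X u xs v" for u xs v
    using that by (induction xs arbitrary: u) (auto simp: dV dD ind g)
  have Q: "graph ?Q"
    using con by (auto simp: graph_def dV dD ind g)
  have "connected_graph ?Q"
    unfolding connected_graph_def
  proof (intro conjI ballI Q)
    fix u w assume "u \<in> verts ?Q" "w \<in> verts ?Q"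
    then obtain u' w' where uw: "u' \<in> verts X" "w' \<in> verts X" "u = ?ov u'" "w = ?ov w'"
      using dV by auto
    then obtain xs where "walk X u' xs w'"
      using con(1) by (auto simp: connected_graph_def)
    then show "\<exists>ds. walk ?Q u ds w"
      using proj uw by metis
  qed
  moreover have "edge_colouring n ?Q"
    by (auto simp: edge_colouring_def dD ind g)
  moreover have "\<exists>!d. d \<in> darts ?Q \<and> beg ?Q d = w \<and> colour ?Q d = i"
    if w: "w \<in> verts ?Q" and i: "i < n" for w i
  proof -
    obtain v where v: "v \<in> verts X" "w = ?ov v"
      using w dV by auto
    obtain x where x: "x \<in> darts X" "beg X x = v" "colour X x = i"
      using ex[OF v(1) i] by blast
    show ?thesis
    proof (rule ex1I[of _ "?od x"])
      show "?od x \<in> darts ?Q \<and> beg ?Q (?od x) = w \<and> colour ?Q (?od x) = i"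
        using x v ind dD by auto
      fix d assume "d \<in> darts ?Q \<and> beg ?Q d = w \<and> colour ?Q d = i"
      then show "d = ?od x"
        using lift1[of d v] v x uniq ind(3) by metis
    qed
  qed
  moreover have "u = w" if far: "far_colours n i j" and w: "walk ?Q u ds w"
    and c: "map (colour ?Q) ds = [i, j, i, j]" for i j u w ds
  proof -
    have "u \<in> verts ?Q"
      using w Q by (cases ds) (auto simp: graph_def)
    then obtain v where v: "v \<in> verts X" "u = ?ov v"
      using dV by auto
    then obtain xs w' where xs: "walk X v xs w'" "ds = map ?od xs" "w = ?ov w'" "set xs \<subseteq> darts X"
      using lift w by blast
    then have "map (colour X) xs = [i, j, i, j]"
      using c ind(3) by (auto simp: subset_iff cong: map_cong)
    then have "v = w'"
      using X far xs(1) unfolding premaniplex_def by metis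
    then show ?thesis
      using v xs by simp
  qed
  ultimately show ?thesis
    unfolding premaniplex_def by (intro conjI allI impI ballI) (assumption | metis)+
qed

end

theory Submission
  imports Defs "HOL-Library.Nat_Bijection"
begin

text \<open>
  Let \<open>W\<close> be the group generated by involutions \<open>r\<^sub>0, \<dots>, r\<^sub>n\<^sub>-\<^sub>1\<close> such that \<open>r\<^sub>i\<close> and \<open>r\<^sub>j\<close>
  commute if \<open>\<bar>i - j\<bar> \<ge> 2\<close>. It acts on the vertices of \<open>X\<close>; let \<open>H\<close> be the stabilizer of a
  vertex \<open>x\<^sub>0\<close>. Suppose that \<open>W\<close> acts on a finite set \<open>Z\<close> over \<open>X\<close>, and that some \<open>w \<in> W\<close> moves a
  point of \<open>Z\<close> over \<open>x\<^sub>0\<close> but no point over any other vertex. Then the pointwise stabilizer \<open>K\<close> of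
  the fibre over \<open>x\<^sub>0\<close> is normal in \<open>H\<close>, and a conjugate of \<open>K\<close> by an element outside \<open>H\<close> contains
  \<open>w\<close>, which \<open>K\<close> does not. So \<open>H\<close> is the normalizer of \<open>K\<close>, and the coset graph of \<open>K\<close> has symmetry
  type graph \<open>X\<close>; it is a maniplex as soon as no \<open>r\<^sub>i\<close> and no \<open>r\<^sub>i r\<^sub>j\<close> with \<open>i \<noteq> j\<close> has a fixed point
  on \<open>Z\<close>.

  The set \<open>Z\<close> is the product of \<open>X\<close> with an explicit finite set, and \<open>w\<close> is a commutator of two
  elements acting trivially on \<open>X\<close>. One of them is \<open>(r\<^sub>1 r\<^sub>2)\<^sup>k\<close>. It moves only the points on a
  long \<open>r\<^sub>1 r\<^sub>2\<close>-cycle through one \<open>r\<^sub>1\<close>-edge that is marked over \<open>x\<^sub>0\<close>. The other is a conjugate of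
  \<open>(r\<^sub>0 r\<^sub>1)\<^sup>k\<close> and moves, among the points of all such cycles, only those in one position. The two
  supports therefore meet over \<open>x\<^sub>0\<close> only.
\<close>

subsection \<open>Premaniplexes as permutation actions\<close>

text \<open>Words in the generators are lists of colours; \<open>fold a u\<close> applies the
  letters from left to right, so \<open>rev u\<close> acts as the inverse of
  \<open>u\<close>.\<close>

locale involutive_action =
  fixes n :: nat and S :: "'s set" and a :: "nat \<Rightarrow> 's \<Rightarrow> 's"
  assumes closed: "i < n \<Longrightarrow> s \<in> S \<Longrightarrow> a i s \<in> S"
    and invol: "i < n \<Longrightarrow> s \<in> S \<Longrightarrow> a i (a i s) = s"
begin

lemma fold_closed: "set u \<subseteq> {..<n} \<Longrightarrow> s \<in> S \<Longrightarrow> fold a u s \<in> S"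
  by (induction u arbitrary: s) (auto simp: closed)

lemma fold_rev: "set u \<subseteq> {..<n} \<Longrightarrow> s \<in> S \<Longrightarrow> fold a (rev u) (fold a u s) = s"
  by (induction u arbitrary: s) (auto simp: closed invol)

lemma fold_rev': "set u \<subseteq> {..<n} \<Longrightarrow> s \<in> S \<Longrightarrow> fold a u (fold a (rev u) s) = s"
  using fold_rev[of "rev u" s] by simp

end

lemma fold_equivariant:
  assumes "\<And>i s. i < n \<Longrightarrow> s \<in> S \<Longrightarrow> a i s \<in> S"
    and "\<And>i s. i < n \<Longrightarrow> s \<in> S \<Longrightarrow> f (a i s) = b i (f s)"
    and "set u \<subseteq> {..<n}" "s \<in> S"
  shows "f (fold a u s) = fold b u (f s)"
  using assms(3,4) by (induction u arbitrary: s) (auto simp: assms(1,2))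

definition dart_at :: "('d, 'v, 'x) cgraph_scheme \<Rightarrow> nat \<Rightarrow> 'v \<Rightarrow> 'd" where
  "dart_at X i v = (THE x. x \<in> darts X \<and> beg X x = v \<and> colour X x = i)"

text \<open>A semiedge of colour \<open>i\<close> at \<open>v\<close> becomes a fixed point of
  \<open>nbr X i\<close>.\<close>

definition nbr :: "('d, 'v, 'x) cgraph_scheme \<Rightarrow> nat \<Rightarrow> 'v \<Rightarrow> 'v" where
  "nbr X i v = beg X (dinv X (dart_at X i v))"

context
  fixes n :: nat and X :: "('d, 'v, 'x) cgraph_scheme"
  assumes X: "premaniplex n X"
begin

lemma premaniplex_dartD:
  assumes "x \<in> darts X"
  shows "beg X x \<in> verts X" "dinv X x \<in> darts X" "dinv X (dinv X x) = x"
    "colour X x < n" "colour X (dinv X x) = colour X x"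
  using X assms by (auto simp: premaniplex_def connected_graph_def graph_def edge_colouring_def)

lemma dart_at:
  assumes "i < n" "v \<in> verts X"
  shows "dart_at X i v \<in> darts X" "beg X (dart_at X i v) = v" "colour X (dart_at X i v) = i"
proof -
  have "\<exists>!x. x \<in> darts X \<and> beg X x = v \<and> colour X x = i"
    using X assms by (auto simp: premaniplex_def)
  from theI'[OF this] show "dart_at X i v \<in> darts X" "beg X (dart_at X i v) = v"
    "colour X (dart_at X i v) = i"
    unfolding dart_at_def by auto
qed

lemma dart_at_eq:
  assumes "x \<in> darts X"
  shows "dart_at X (colour X x) (beg X x) = x"
proof -
  have "\<exists>!y. y \<in> darts X \<and> beg X y = beg X x \<and> colour X y = colour X x"
    using X premaniplex_dartD[OF assms] by (auto simp: premaniplex_def)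
  then show ?thesis
    using assms unfolding dart_at_def by (intro the1_equality) auto
qed

lemma dinv_dart_at:
  assumes "i < n" "v \<in> verts X"
  shows "dinv X (dart_at X i v) = dart_at X i (nbr X i v)"
  using dart_at_eq[of "dinv X (dart_at X i v)"] dart_at[OF assms] premaniplex_dartD
  by (simp add: nbr_def)

lemma involutive_action_nbr: "involutive_action n (verts X) (nbr X)"
proof
  fix i v assume iv: "i < n" "v \<in> verts X"
  note d = dart_at[OF iv]
  show "nbr X i v \<in> verts X"
    using premaniplex_dartD d by (simp add: nbr_def)
  show "nbr X i (nbr X i v) = v"
    using premaniplex_dartD d dinv_dart_at[OF iv] by (metis nbr_def)
qed

lemma walk_word:
  assumes "set u \<subseteq> {..<n}" "v \<in> verts X"
  shows "\<exists>xs. walk X v xs (fold (nbr X) u v) \<and> map (colour X) xs = u"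
  using assms
proof (induction u arbitrary: v)
  case Nil
  then show ?case by (intro exI[of _ "[]"]) auto
next
  case (Cons i u)
  then have i: "i < n" by auto
  obtain xs where "walk X (nbr X i v) xs (fold (nbr X) u (nbr X i v))" "map (colour X) xs = u"
    using Cons involutive_action.closed[OF involutive_action_nbr, of i v] by fastforce
  moreover have "beg X (dinv X (dart_at X i v)) = nbr X i v"
    by (simp add: nbr_def)
  ultimately show ?case
    using dart_at[OF i Cons.prems(2)]
    by (intro exI[of _ "dart_at X i v # xs"]) auto
qed

lemma word_of_walk:
  assumes "walk X v xs w"
  shows "set (map (colour X) xs) \<subseteq> {..<n} \<and> fold (nbr X) (map (colour X) xs) v = w"
  using assms
proof (induction xs arbitrary: v)
  case (Cons x xs)
  then show ?case
    using premaniplex_dartD[of x] dart_at_eq[of x] by (auto simp: nbr_def)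
qed auto

lemma nbr_connected:
  assumes "v \<in> verts X" "w \<in> verts X"
  shows "\<exists>u. set u \<subseteq> {..<n} \<and> fold (nbr X) u v = w"
proof -
  have "connected_graph X"
    using X by (simp add: premaniplex_def)
  then obtain xs where "walk X v xs w"
    using assms unfolding connected_graph_def by blast
  then show ?thesis
    using word_of_walk by blast
qed

lemma nbr_commute:
  assumes far: "far_colours n i j" and v: "v \<in> verts X"
  shows "nbr X i (nbr X j v) = nbr X j (nbr X i v)"
proof -
  interpret involutive_action n "verts X" "nbr X" by (rule involutive_action_nbr)
  have ij: "i < n" "j < n" using far by (auto simp: far_colours_def)
  have "set [i, j, i, j] \<subseteq> {..<n}" using ij by simp
  from walk_word[OF this v] obtain xs where
    xs: "walk X v xs (fold (nbr X) [i, j, i, j] v) \<and> map (colour X) xs = [i, j, i, j]" ..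
  have "\<forall>i j u v xs. far_colours n i j \<and> walk X u xs v \<and> map (colour X) xs = [i, j, i, j] \<longrightarrow> u = v"
    using X unfolding premaniplex_def by (elim conjE)
  from this[rule_format, OF conjI[OF far xs]] have "v = fold (nbr X) [i, j, i, j] v" .
  then have "nbr X j (nbr X i (nbr X j (nbr X i v))) = v"
    by simp
  then show ?thesis
    using ij v by (metis closed invol)
qed

end

subsection \<open>Symmetry type graphs of action graphs\<close>

text \<open>The last two assumptions say that the orbits of the automorphism group are the fibres of \<open>\<pi>\<close>.\<close>

locale cover_action = involutive_action n S a
  for n :: nat and S :: "'s set" and a :: "nat \<Rightarrow> 's \<Rightarrow> 's" +
  fixes X :: "('d, 'v, 'x) cgraph_scheme" and \<pi> :: "'s \<Rightarrow> 'v"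
  assumes X: "premaniplex n X"
    and fin: "finite S" and nonempty: "S \<noteq> {}"
    and no_fix: "i < n \<Longrightarrow> s \<in> S \<Longrightarrow> a i s \<noteq> s"
    and no_par: "i < n \<Longrightarrow> j < n \<Longrightarrow> s \<in> S \<Longrightarrow> a i s = a j s \<Longrightarrow> i = j"
    and commute: "far_colours n i j \<Longrightarrow> s \<in> S \<Longrightarrow> a i (a j s) = a j (a i s)"
    and transitive: "s \<in> S \<Longrightarrow> t \<in> S \<Longrightarrow> \<exists>u. set u \<subseteq> {..<n} \<and> fold a u s = t"
    and proj: "s \<in> S \<Longrightarrow> \<pi> s \<in> verts X"
    and proj_act: "i < n \<Longrightarrow> s \<in> S \<Longrightarrow> \<pi> (a i s) = nbr X i (\<pi> s)"
    and lift: "s \<in> S \<Longrightarrow> t \<in> S \<Longrightarrow> \<pi> s = \<pi> t \<Longrightarrow>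
      \<exists>f. f \<in> S \<rightarrow> S \<and> (\<forall>i<n. \<forall>s\<in>S. f (a i s) = a i (f s)) \<and> f s = t"
    and separate: "s \<in> S \<Longrightarrow> t \<in> S \<Longrightarrow> \<pi> s \<noteq> \<pi> t \<Longrightarrow>
      \<exists>u. set u \<subseteq> {..<n} \<and> fold a u s = s \<and> fold a u t \<noteq> t"

text \<open>A dart is a state together with a colour; the pair is coded as a natural number to
  obtain a graph of the type in the theorem.\<close>

definition action_graph :: "nat \<Rightarrow> nat set \<Rightarrow> (nat \<Rightarrow> nat \<Rightarrow> nat) \<Rightarrow> (nat, nat) cgraph" where
  "action_graph n S a =
     \<lparr>darts = prod_encode ` (S \<times> {..<n}), verts = S,
      beg = (\<lambda>x. fst (prod_decode x)),
      dinv = (\<lambda>x. case prod_decode x of (s, i) \<Rightarrow> prod_encode (a i s, i)),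
      colour = (\<lambda>x. snd (prod_decode x))\<rparr>"

lemma action_graph_simps [simp]:
  "darts (action_graph n S a) = prod_encode ` (S \<times> {..<n})"
  "verts (action_graph n S a) = S"
  "beg (action_graph n S a) (prod_encode (s, i)) = s"
  "dinv (action_graph n S a) (prod_encode (s, i)) = prod_encode (a i s, i)"
  "colour (action_graph n S a) (prod_encode (s, i)) = i"
  by (auto simp: action_graph_def)

context
  fixes n :: nat and S :: "nat set" and a :: "nat \<Rightarrow> nat \<Rightarrow> nat"
    and X :: "('d, 'v, 'x) cgraph_scheme" and \<pi> :: "nat \<Rightarrow> 'v"
  assumes cov: "cover_action n S a X \<pi>"
begin

interpretation cover_action n S a X \<pi> by (rule cov)

abbreviation (input) "G \<equiv> action_graph n S a"

lemma graph_G: "graph G"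
  using nonempty by (auto simp: graph_def closed invol)

lemma walk_G:
  assumes "walk G s xs t"
  shows "s \<in> S \<and> set (map (colour G) xs) \<subseteq> {..<n} \<and> fold a (map (colour G) xs) s = t"
  using assms by (induction xs arbitrary: s) auto

lemma walk_G_ex:
  assumes "set u \<subseteq> {..<n}" "s \<in> S"
  shows "\<exists>xs. walk G s xs (fold a u s)"
  using assms
proof (induction u arbitrary: s)
  case Nil
  then show ?case by (intro exI[of _ "[]"]) auto
next
  case (Cons i u)
  then obtain xs where "walk G (a i s) xs (fold a u (a i s))"
    using closed[of i s] by fastforce
  then show ?case
    using Cons.prems by (intro exI[of _ "prod_encode (s, i) # xs"]) auto
qed

lemma premaniplex_G: "premaniplex n G"
proof -
  have "connected_graph G"
    unfolding connected_graph_def using graph_G walk_G_ex transitive by (metis action_graph_simps(2))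
  moreover have "edge_colouring n G"
    by (auto simp: edge_colouring_def)
  moreover have "\<forall>v\<in>verts G. \<forall>i<n. \<exists>!x. x \<in> darts G \<and> beg G x = v \<and> colour G x = i"
  proof (intro ballI allI impI)
    fix v i assume "v \<in> verts G" "i < n"
    then show "\<exists>!x. x \<in> darts G \<and> beg G x = v \<and> colour G x = i"
      by (intro ex1I[of _ "prod_encode (v, i)"]) auto
  qed
  moreover have "\<forall>i j u v xs. far_colours n i j \<and> walk G u xs v \<and> map (colour G) xs = [i, j, i, j]
      \<longrightarrow> u = v"
  proof (intro allI impI, elim conjE)
    fix i j u v xs
    assume far: "far_colours n i j" and w: "walk G u xs v" "map (colour G) xs = [i, j, i, j]"
    have "u \<in> S" "a j (a i (a j (a i u))) = v" "i < n" "j < n"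
      using walk_G[OF w(1)] w(2) far by (auto simp: far_colours_def)
    then show "u = v"
      using commute[OF far, of u] closed invol by metis
  qed
  ultimately show ?thesis
    unfolding premaniplex_def by (intro conjI)
qed

lemma maniplex_G: "maniplex n G"
proof (rule premaniplex_imp_maniplex[OF premaniplex_G])
  show "\<not> has_semiedges G"
    using no_fix by (auto simp: has_semiedges_def prod_encode_eq)
  show "\<not> has_parallel_edges G"
  proof
    assume "has_parallel_edges G"
    then obtain x y where "x \<in> darts G" "y \<in> darts G" and xy: "edge_of G x \<noteq> edge_of G y"
      "endpoints G x = endpoints G y"
      unfolding has_parallel_edges_def by blast
    then obtain s i t j where st: "s \<in> S" "i < n" "t \<in> S" "j < n"
      and eq: "x = prod_encode (s, i)" "y = prod_encode (t, j)"
      by auto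
    have st': "{s, a i s} = {t, a j t}"
      using xy(2) unfolding eq endpoints_def by simp
    from st' consider "s = t" "a i s = a j t" | "s = a j t" "a i s = t"
      by (auto simp: doubleton_eq_iff)
    then show False
    proof cases
      case 1
      then show False using st no_par xy(1) eq by metis
    next
      case 2
      then have "a i s = a j s" using st invol by metis
      then have "i = j" using st no_par by metis
      then show False using 2 st xy(1) invol unfolding eq edge_of_def by auto
    qed
  qed
qed

lemma finite_G: "finite_graph G"
  using fin by (auto simp: finite_graph_def)

text \<open>Tail and colour determine a dart, so the vertex map determines the dart map;
  compatibility with \<open>dinv\<close> then says that the vertex map commutes with the
  action.\<close>

lemma iso_commute:
  assumes "(f, h) \<in> cgraph_iso G G" "i < n" "s \<in> S"
  shows "f s \<in> S" "h (prod_encode (s, i)) = prod_encode (f s, i)" "f (a i s) = a i (f s)"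
proof -
  have hd: "\<And>x. x \<in> darts G \<Longrightarrow> h x \<in> darts G \<and> beg G (h x) = f (beg G x)
      \<and> dinv G (h x) = h (dinv G x) \<and> colour G (h x) = colour G x"
    and "f s \<in> S"
    using assms by (auto simp: cgraph_iso_def cgraph_hom_def)
  then show "f s \<in> S" by simp
  have *: "h (prod_encode (s, i)) = prod_encode (f s, i)" if "s \<in> S" for s
  proof -
    have "prod_encode (s, i) \<in> darts G" using that assms by auto
    from hd[OF this] show ?thesis by auto
  qed
  show "h (prod_encode (s, i)) = prod_encode (f s, i)" by (rule *[OF assms(3)])
  have "prod_encode (s, i) \<in> darts G" using assms by auto
  from hd[OF this] show "f (a i s) = a i (f s)"
    using *[OF assms(3)] *[OF closed[OF assms(2,3)]] by (simp add: prod_encode_eq)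
qed

text \<open>Transitivity makes an equivariant map surjective, and finiteness of \<open>S\<close>
  makes it bijective.\<close>

lemma iso_of_equivariant:
  assumes f: "f \<in> S \<rightarrow> S" "\<forall>i<n. \<forall>s\<in>S. f (a i s) = a i (f s)"
  shows "\<exists>g\<in>carrier (Aut G). (\<forall>s\<in>S. fst g s = f s)
    \<and> (\<forall>s\<in>S. \<forall>i<n. snd g (prod_encode (s, i)) = prod_encode (f s, i))"
proof -
  have "S \<subseteq> f ` S"
  proof
    fix t assume t: "t \<in> S"
    obtain s where s: "s \<in> S" using nonempty by auto
    then obtain u where u: "set u \<subseteq> {..<n}" "fold a u (f s) = t"
      using transitive[of "f s" t] f t by auto
    have "f (fold a u s) = t"
      using fold_equivariant[of n S a f a u s] u f s closed by auto
    then show "t \<in> f ` S" using fold_closed u s by blast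
  qed
  then have bf: "bij_betw f S S"
    using f fin by (simp add: bij_betw_def finite_surj_inj image_subset_iff_funcset subset_antisym)
  define h where "h x = (case prod_decode x of (s, i) \<Rightarrow> prod_encode (f s, i))" for x
  have bh: "bij_betw h (darts G) (darts G)"
    unfolding bij_betw_def
  proof
    show "inj_on h (darts G)"
      using bf by (auto simp: inj_on_def h_def prod_encode_eq bij_betw_def)
    show "h ` darts G = darts G"
    proof
      show "h ` darts G \<subseteq> darts G" using f by (auto simp: h_def)
      show "darts G \<subseteq> h ` darts G"
      proof
        fix y assume "y \<in> darts G"
        then obtain t i where y: "y = prod_encode (t, i)" "t \<in> S" "i < n" by auto
        then obtain s where "s \<in> S" "t = f s" using \<open>S \<subseteq> f ` S\<close> by auto
        then have "y = h (prod_encode (s, i))" "prod_encode (s, i) \<in> darts G"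
          using y by (auto simp: h_def)
        then show "y \<in> h ` darts G" by blast
      qed
    qed
  qed
  let ?g = "(restrict f (verts G), restrict h (darts G))"
  have hp: "h (prod_encode (s, i)) = prod_encode (f s, i)" for s i
    by (simp add: h_def)
  have 1: "bij_betw (restrict f (verts G)) (verts G) (verts G)"
    "bij_betw (restrict h (darts G)) (darts G) (darts G)"
    using bf bh by (simp_all only: bij_betw_restrict_eq action_graph_simps)
  have "?g \<in> cgraph_iso G G"
    using 1 f by (auto simp: cgraph_iso_def cgraph_hom_def hp closed)
  then have "?g \<in> carrier (Aut G)"
    using 1 by (simp add: carrier_Aut Bij_def)
  then show ?thesis
    by (intro bexI[of _ ?g]) (auto simp: hp)
qed

text \<open>\<open>lift\<close> puts each fibre into one orbit. Conversely, an automorphism commutes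
  with words, so every word fixing \<open>s\<close> fixes its image; \<open>separate\<close>
  excludes this for points of different fibres.\<close>

lemma orbit_verts_eq:
  assumes "s \<in> S"
  shows "orbit (Aut G) fst s = {t \<in> S. \<pi> t = \<pi> s}"
proof
  show "{t \<in> S. \<pi> t = \<pi> s} \<subseteq> orbit (Aut G) fst s"
  proof
    fix t assume "t \<in> {t \<in> S. \<pi> t = \<pi> s}"
    then obtain f where "f \<in> S \<rightarrow> S" "\<forall>i<n. \<forall>s\<in>S. f (a i s) = a i (f s)" "f s = t"
      using lift[of s t] assms by auto
    then obtain g where "g \<in> carrier (Aut G)" "fst g s = t"
      using iso_of_equivariant[of f] assms by metis
    then show "t \<in> orbit (Aut G) fst s"
      unfolding orbit_def by blast
  qed
  show "orbit (Aut G) fst s \<subseteq> {t \<in> S. \<pi> t = \<pi> s}"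
  proof
    fix t assume "t \<in> orbit (Aut G) fst s"
    then obtain g where g: "g \<in> carrier (Aut G)" "t = fst g s"
      by (auto simp: orbit_def)
    obtain f h where fh: "g = (f, h)" by (cases g)
    have iso: "(f, h) \<in> cgraph_iso G G"
      using g fh by (auto simp: carrier_Aut)
    have bij: "bij_betw f S S"
      using iso by (auto simp: cgraph_iso_def)
    have t: "t = f s" "t \<in> S"
      using g fh assms bij by (auto dest: bij_betwE)
    have "\<pi> t = \<pi> s"
    proof (rule ccontr)
      assume "\<pi> t \<noteq> \<pi> s"
      then obtain u where u: "set u \<subseteq> {..<n}" "fold a u s = s" "fold a u t \<noteq> t"
        using separate[of s t] assms t by auto
      have "f (fold a u s) = fold a u (f s)"
        using fold_equivariant[of n S a f a u s] iso_commute[OF iso] closed u assms by blast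
      then show False using u t by simp
    qed
    then show "t \<in> {t \<in> S. \<pi> t = \<pi> s}" using t by simp
  qed
qed

lemma orbit_darts_eq:
  assumes "s \<in> S" "i < n"
  shows "orbit (Aut G) snd (prod_encode (s, i)) = (\<lambda>t. prod_encode (t, i)) ` {t \<in> S. \<pi> t = \<pi> s}"
proof -
  have "snd g (prod_encode (s, i)) = prod_encode (fst g s, i)" if "g \<in> carrier (Aut G)" for g
    using iso_commute(2)[of "fst g" "snd g" i s] that assms by (auto simp: carrier_Aut)
  moreover have "orbit (Aut G) fst s = (\<lambda>g. fst g s) ` carrier (Aut G)"
    "orbit (Aut G) snd x = (\<lambda>g. snd g x) ` carrier (Aut G)" for x
    unfolding orbit_def by blast+
  ultimately have "orbit (Aut G) snd (prod_encode (s, i)) = (\<lambda>t. prod_encode (t, i)) ` orbit (Aut G) fst s"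
    by (simp add: image_image cong: image_cong)
  then show ?thesis using orbit_verts_eq[OF assms(1)] by simp
qed

lemma proj_surj: "\<pi> ` S = verts X"
proof
  show "\<pi> ` S \<subseteq> verts X" using proj by auto
  show "verts X \<subseteq> \<pi> ` S"
  proof
    fix v assume v: "v \<in> verts X"
    obtain s where s: "s \<in> S" using nonempty by auto
    then obtain u where u: "set u \<subseteq> {..<n}" "fold (nbr X) u (\<pi> s) = v"
      using nbr_connected[OF X] proj v by meson
    then have "\<pi> (fold a u s) = v"
      using fold_equivariant[of n S a \<pi> "nbr X" u s] closed proj_act s by auto
    then show "v \<in> \<pi> ` S" using fold_closed u s by blast
  qed
qed

text \<open>An orbit of vertices goes to the common value of \<open>\<pi>\<close> on it, and an
  orbit of darts to the dart of \<open>X\<close> that has its colour and starts at that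
  value.\<close>

lemma STG_G: "isomorphic_cgraphs (STG G) X"
proof -
  let ?Q = "STG G"
  define f where "f T = (THE v. \<pi> ` T = {v})" for T
  define h where "h D = dart_at X (the_elem (colour G ` D)) (f (beg G ` D))" for D
  let ?V = "\<lambda>s. {t \<in> S. \<pi> t = \<pi> s}" and ?D = "\<lambda>s i. (\<lambda>t. prod_encode (t, i)) ` {t \<in> S. \<pi> t = \<pi> s}"
  have V: "verts ?Q = ?V ` S"
    using orbit_verts_eq by (auto simp: STG_def quotient_cgraph_def orbits_def)
  have D: "darts ?Q = (\<lambda>(s, i). ?D s i) ` (S \<times> {..<n})"
  proof -
    have "darts ?Q = (\<lambda>x. orbit (Aut G) snd (prod_encode x)) ` (S \<times> {..<n})"
      by (simp add: STG_def quotient_cgraph_def orbits_def Setcompr_eq_image image_image)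
    also have "\<dots> = (\<lambda>(s, i). ?D s i) ` (S \<times> {..<n})"
    proof (rule image_cong)
      fix x assume "x \<in> S \<times> {..<n}"
      then show "orbit (Aut G) snd (prod_encode x) = (case x of (s, i) \<Rightarrow> ?D s i)"
        using orbit_darts_eq[of "fst x" "snd x"] by (cases x) simp
    qed simp
    finally show ?thesis .
  qed
  have pV: "\<pi> ` ?V s = {\<pi> s}" if "s \<in> S" for s using that by auto
  have fV: "f (?V s) = \<pi> s" if "s \<in> S" for s
    unfolding f_def pV[OF that] by auto
  have bD: "beg G ` ?D s i = ?V s" for s i by (auto simp: image_image)
  have cD: "colour G ` ?D s i = {i}" if "s \<in> S" for s i using that by (auto simp: image_image)
  have hD: "h (?D s i) = dart_at X i (\<pi> s)" if "s \<in> S" for s i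
    unfolding h_def bD cD[OF that] fV[OF that] by simp
  have iD: "dinv G ` ?D s i = ?D (a i s) i" if s: "s \<in> S" "i < n" for s i
  proof -
    have "dinv G ` ?D s i = (\<lambda>t. prod_encode (t, i)) ` (a i ` ?V s)"
      by (auto simp: image_image)
    also have "a i ` ?V s = ?V (a i s)"
    proof
      show "a i ` ?V s \<subseteq> ?V (a i s)" using s closed proj_act by auto
      show "?V (a i s) \<subseteq> a i ` ?V s"
      proof
        fix t assume t: "t \<in> ?V (a i s)"
        then have "\<pi> (a i t) = \<pi> s"
          using proj_act[of i t] proj_act[of i "a i s"] closed invol s by auto
        then have "a i t \<in> ?V s" "t = a i (a i t)"
          using t s closed invol by auto
        then show "t \<in> a i ` ?V s" by blast
      qed
    qed
    finally show ?thesis .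
  qed
  have Q: "beg ?Q T = beg G ` T" "dinv ?Q T = dinv G ` T" "colour ?Q T = the_elem (colour G ` T)" for T
    by (auto simp: STG_def quotient_cgraph_def)
  have hom: "(f, h) \<in> cgraph_hom ?Q X"
    unfolding cgraph_hom_def
  proof (clarify, intro conjI)
    show "f \<in> verts ?Q \<rightarrow> verts X"
      unfolding V using fV proj by auto
    show "h \<in> darts ?Q \<rightarrow> darts X"
      unfolding D using hD dart_at(1)[OF X] proj by auto
    show "\<forall>x\<in>darts ?Q. beg X (h x) = f (beg ?Q x) \<and> dinv X (h x) = h (dinv ?Q x)
        \<and> colour X (h x) = colour ?Q x"
    proof
      fix x assume "x \<in> darts ?Q"
      then obtain s i where x: "x = ?D s i" and s: "s \<in> S" "i < n"
        unfolding D by auto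
      show "beg X (h x) = f (beg ?Q x) \<and> dinv X (h x) = h (dinv ?Q x) \<and> colour X (h x) = colour ?Q x"
        unfolding x Q bD cD[OF s(1)] iD[OF s] hD[OF s(1)] hD[OF closed[OF s(2,1)]] fV[OF s(1)]
        using dart_at[OF X s(2) proj[OF s(1)]] dinv_dart_at[OF X s(2) proj[OF s(1)]] proj_act s
        by simp
    qed
  qed
  have "bij_betw f (verts ?Q) (verts X)"
    unfolding bij_betw_def V
  proof
    show "inj_on f (?V ` S)" using fV by (auto simp: inj_on_def)
    show "f ` ?V ` S = verts X" using fV proj_surj by (simp add: image_image)
  qed
  moreover have "bij_betw h (darts ?Q) (darts X)"
    unfolding bij_betw_def
  proof
    show "inj_on h (darts ?Q)"
    proof (rule inj_onI)
      fix x y assume "x \<in> darts ?Q" "y \<in> darts ?Q" and e: "h x = h y"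
      then obtain s i t j where x: "x = ?D s i" "s \<in> S" "i < n" and y: "y = ?D t j" "t \<in> S" "j < n"
        unfolding D by auto
      have "dart_at X i (\<pi> s) = dart_at X j (\<pi> t)"
        using e hD x y by simp
      then have "i = j" "\<pi> s = \<pi> t"
        using dart_at[OF X x(3) proj[OF x(2)]] dart_at[OF X y(3) proj[OF y(2)]] by auto
      then show "x = y" using x y by simp
    qed
    show "h ` darts ?Q = darts X"
    proof
      show "h ` darts ?Q \<subseteq> darts X" using hom by (auto simp: cgraph_hom_def)
      show "darts X \<subseteq> h ` darts ?Q"
      proof
        fix x assume x: "x \<in> darts X"
        then obtain s where s: "s \<in> S" "\<pi> s = beg X x"
          using premaniplex_dartD(1)[OF X x] proj_surj by (metis imageE)
        then have "h (?D s (colour X x)) = x"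
          using hD[OF s(1)] dart_at_eq[OF X x] by simp
        moreover have "?D s (colour X x) \<in> darts ?Q"
          unfolding D using s premaniplex_dartD(4)[OF X x]
          by (intro image_eqI[of _ _ "(s, colour X x)"]) auto
        ultimately show "x \<in> h ` darts ?Q" by (rule image_eqI[OF sym])
      qed
    qed
  qed
  ultimately have "(f, h) \<in> cgraph_iso ?Q X"
    using hom by (simp add: cgraph_iso_def)
  then show ?thesis unfolding isomorphic_cgraphs_def by blast
qed

end

section \<open>Transport to the natural numbers\<close>

context cover_action
begin

lemma cover_action_nat:
  "\<exists>(S' :: nat set) a' \<pi>'. cover_action n S' a' X \<pi>'"
proof -
  obtain e and T :: "nat set" where bij: "bij_betw e S T" and T: "finite T"
    using ex_bij_betw_finite_nat[OF fin] by blast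
  define d where "d = inv_into S e"
  have e: "e s \<in> T" "d (e s) = s" if "s \<in> S" for s
    using bij that by (auto simp: d_def bij_betw_inv_into_left dest: bij_betwE)
  have d: "d x \<in> S" "e (d x) = x" if "x \<in> T" for x
    using bij_betwE[OF bij_betw_inv_into[OF bij]] bij_betw_inv_into_right[OF bij] that
    by (auto simp: d_def)
  define a' where "a' i x = e (a i (d x))" for i x
  have fold': "fold a' u x = e (fold a u (d x))" if "set u \<subseteq> {..<n}" "x \<in> T" for u x
    using that by (induction u arbitrary: x) (auto simp: a'_def e d closed)
  have "cover_action n T a' X (\<lambda>x. \<pi> (d x))"
  proof (intro cover_action.intro involutive_action.intro cover_action_axioms.intro)
    show "premaniplex n X" by (rule X)
    show "finite T" by (rule T)
    show "T \<noteq> {}" using e(1) nonempty by blast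
    fix i x assume i: "i < n" and x: "x \<in> T"
    show "a' i x \<in> T"
      unfolding a'_def using i x e d closed by blast
    show "a' i (a' i x) = x"
      unfolding a'_def using i x e d closed invol by simp
    show "a' i x \<noteq> x"
      unfolding a'_def using i x e d closed no_fix by metis
    show "\<pi> (d (a' i x)) = nbr X i (\<pi> (d x))"
      unfolding a'_def using i x e d closed proj_act by simp
  next
    fix i j x assume "i < n" "j < n" "x \<in> T" "a' i x = a' j x"
    then show "i = j"
      unfolding a'_def using e d closed no_par by metis
  next
    fix i j x assume far: "far_colours n i j" and x: "x \<in> T"
    then have "i < n" "j < n" by (auto simp: far_colours_def)
    then show "a' i (a' j x) = a' j (a' i x)"
      unfolding a'_def using commute[OF far] x e d closed by simp
  next
    fix x y assume xy: "x \<in> T" "y \<in> T"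
    then obtain u where u: "set u \<subseteq> {..<n}" "fold a u (d x) = d y"
      using transitive d(1) by meson
    then show "\<exists>u. set u \<subseteq> {..<n} \<and> fold a' u x = y"
      using fold' xy d(2) by metis
  next
    fix x assume "x \<in> T"
    then show "\<pi> (d x) \<in> verts X" using proj d by blast
  next
    fix x y assume xy: "x \<in> T" "y \<in> T" "\<pi> (d x) = \<pi> (d y)"
    then obtain f where f: "f \<in> S \<rightarrow> S" "\<forall>i<n. \<forall>s\<in>S. f (a i s) = a i (f s)" "f (d x) = d y"
      using lift d(1) by meson
    have fS: "f s \<in> S" if "s \<in> S" for s using f(1) that by auto
    show "\<exists>f. f \<in> T \<rightarrow> T
        \<and> (\<forall>i<n. \<forall>s\<in>T. f (a' i s) = a' i (f s)) \<and> f x = y"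
    proof (intro exI[of _ "\<lambda>x. e (f (d x))"] conjI allI impI ballI)
      show "(\<lambda>x. e (f (d x))) \<in> T \<rightarrow> T"
        using e(1) d(1) fS by blast
      show "e (f (d x)) = y" using f xy d by simp
      fix i s assume "i < n" "s \<in> T"
      then show "e (f (d (a' i s))) = a' i (e (f (d s)))"
        unfolding a'_def using f(2) fS d e closed by simp
    qed
  next
    fix x y assume xy: "x \<in> T" "y \<in> T" "\<pi> (d x) \<noteq> \<pi> (d y)"
    then obtain u where u: "set u \<subseteq> {..<n}" "fold a u (d x) = d x" "fold a u (d y) \<noteq> d y"
      using separate d(1) by meson
    have "e (fold a u (d y)) \<noteq> y"
      using u xy d fold_closed e(2) by metis
    then show "\<exists>u. set u \<subseteq> {..<n} \<and> fold a' u x = x \<and> fold a' u y \<noteq> y"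
      using u xy fold' d(2) by metis
  qed
  then show ?thesis by blast
qed

lemma ex_maniplex:
  "\<exists>M :: (nat, nat) cgraph. maniplex n M \<and> finite_graph M \<and> isomorphic_cgraphs (STG M) X"
  using cover_action_nat maniplex_G finite_G STG_G by blast

end

subsection \<open>The stabilizer of a fibre\<close>

text \<open>The action on \<open>Z\<close> may have several orbits; a transitive action arises from
  it by letting words act on a single fibre.\<close>

locale marked_action = involutive_action n Z R
  for n :: nat and Z :: "'z set" and R :: "nat \<Rightarrow> 'z \<Rightarrow> 'z" +
  fixes X :: "('d, 'v, 'x) cgraph_scheme" and p :: "'z \<Rightarrow> 'v" and w :: "nat list" and z0 :: 'z
  assumes X: "premaniplex n X"
    and fin: "finite Z"
    and no_fix: "i < n \<Longrightarrow> z \<in> Z \<Longrightarrow> R i z \<noteq> z"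
    and no_par: "i < n \<Longrightarrow> j < n \<Longrightarrow> z \<in> Z \<Longrightarrow> R i z = R j z \<Longrightarrow> i = j"
    and commute: "far_colours n i j \<Longrightarrow> z \<in> Z \<Longrightarrow> R i (R j z) = R j (R i z)"
    and proj: "z \<in> Z \<Longrightarrow> p z \<in> verts X"
    and proj_act: "i < n \<Longrightarrow> z \<in> Z \<Longrightarrow> p (R i z) = nbr X i (p z)"
    and w: "set w \<subseteq> {..<n}"
    and z0: "z0 \<in> Z" "fold R w z0 \<noteq> z0"
    and w_fix: "z \<in> Z \<Longrightarrow> p z \<noteq> p z0 \<Longrightarrow> fold R w z = z"
begin

definition F where "F = {z \<in> Z. p z = p z0}"

text \<open>The states are the cosets of the pointwise stabilizer of \<open>F\<close>.\<close>

definition state where "state u = restrict (fold R u) F"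

text \<open>Right multiplication of a coset by the generator of colour \<open>i\<close>.\<close>

definition step where "step i m = (\<lambda>z\<in>F. R i (m z))"

lemma fold_proj:
  assumes "set u \<subseteq> {..<n}" "z \<in> Z"
  shows "p (fold R u z) = fold (nbr X) u (p z)"
  using fold_equivariant[of n Z R p "nbr X" u z] assms closed proj_act by blast

lemma step_state: "step i (state u) = state (u @ [i])"
  by (auto simp: step_def state_def)

lemma fold_step: "fold step v (state u) = state (u @ v)"
  by (induction v arbitrary: u) (auto simp: step_state)

lemma state_eqI: "(\<And>z. z \<in> F \<Longrightarrow> fold R u z = fold R v z) \<Longrightarrow> state u = state v"
  unfolding state_def by (rule restrict_ext)

lemma state_neqI: "z \<in> F \<Longrightarrow> fold R u z \<noteq> fold R v z \<Longrightarrow> state u \<noteq> state v"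
  unfolding state_def by (metis restrict_apply')

lemma FD: "z \<in> F \<Longrightarrow> z \<in> Z" "z \<in> F \<Longrightarrow> p z = p z0"
  by (auto simp: F_def)

lemma z0_F: "z0 \<in> F"
  using z0 by (simp add: F_def)

lemma state_z0: "state u z0 = fold R u z0"
  using z0_F by (simp add: state_def)

lemma cover_action_states:
  "cover_action n (state ` {u. set u \<subseteq> {..<n}}) step X (\<lambda>m. p (m z0))"
proof (intro cover_action.intro involutive_action.intro cover_action_axioms.intro)
  let ?U = "{u. set u \<subseteq> {..<n}}"
  show "premaniplex n X" by (rule X)
  have "state u \<in> F \<rightarrow>\<^sub>E Z" if "u \<in> ?U" for u
    using that fold_closed FD by (auto simp: state_def)
  then show "finite (state ` ?U)"
    using finite_PiE[of F "\<lambda>_. Z"] fin by (auto simp: F_def intro: finite_subset)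
  have "[] \<in> ?U" by simp
  then show "state ` ?U \<noteq> {}" by blast
  fix i m assume i: "i < n" and "m \<in> state ` ?U"
  then obtain u where m: "m = state u" and u: "set u \<subseteq> {..<n}" by blast
  have ui: "u @ [i] \<in> ?U" using u i by simp
  then show "step i m \<in> state ` ?U"
    unfolding m step_state by blast
  show "step i (step i m) = m"
    unfolding m step_state using u i by (intro state_eqI) (simp add: invol fold_closed FD)
  show "step i m \<noteq> m"
    unfolding m step_state using no_fix[OF i fold_closed[OF u z0(1)]] z0_F
    by (intro state_neqI[of z0]) auto
  show "p (step i m z0) = nbr X i (p (m z0))"
    unfolding m step_state state_z0 using proj_act[OF i fold_closed[OF u z0(1)]] by simp
next
  fix i j m assume ij: "i < n" "j < n" and "m \<in> state ` {u. set u \<subseteq> {..<n}}" and eq: "step i m = step j m"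
  then obtain u where m: "m = state u" and u: "set u \<subseteq> {..<n}" by blast
  have "R i (fold R u z0) = R j (fold R u z0)"
    using arg_cong[OF eq, of "\<lambda>f. f z0"] unfolding m step_state state_z0 by simp
  then show "i = j"
    using no_par ij fold_closed[OF u z0(1)] by blast
next
  fix i j m assume far: "far_colours n i j" and "m \<in> state ` {u. set u \<subseteq> {..<n}}"
  then obtain u where m: "m = state u" and u: "set u \<subseteq> {..<n}" by blast
  show "step i (step j m) = step j (step i m)"
    unfolding m step_state using u by (intro state_eqI) (simp add: commute[OF far] fold_closed FD)
next
  fix s t assume "s \<in> state ` {u. set u \<subseteq> {..<n}}" "t \<in> state ` {u. set u \<subseteq> {..<n}}"
  then obtain u v where s: "s = state u" and u: "set u \<subseteq> {..<n}"
    and t: "t = state v" and v: "set v \<subseteq> {..<n}" by blast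
  have "state (u @ rev u @ v) = state v"
    using u by (intro state_eqI) (simp add: fold_rev FD)
  then show "\<exists>u. set u \<subseteq> {..<n} \<and> fold step u s = t"
    unfolding s t using u v by (intro exI[of _ "rev u @ v"]) (simp add: fold_step)
next
  fix m assume "m \<in> state ` {u. set u \<subseteq> {..<n}}"
  then show "p (m z0) \<in> verts X"
    using state_z0 proj fold_closed z0 by auto
next
  interpret X: involutive_action n "verts X" "nbr X"
    by (rule involutive_action_nbr[OF X])
  let ?S = "state ` {u. set u \<subseteq> {..<n}}"
  fix s t assume "s \<in> ?S" "t \<in> ?S" and eq: "p (s z0) = p (t z0)"
  then obtain u v where s: "s = state u" and u: "set u \<subseteq> {..<n}"
    and t: "t = state v" and v: "set v \<subseteq> {..<n}" by blast
  have eq': "fold (nbr X) u (p z0) = fold (nbr X) v (p z0)"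
    using eq fold_proj[OF u z0(1)] fold_proj[OF v z0(1)] by (simp add: s t state_z0)
  \<comment> \<open>\<open>h\<close> permutes \<open>F\<close>; precomposition with it is left multiplication of cosets.\<close>
  let ?h = "v @ rev u"
  have h: "set ?h \<subseteq> {..<n}" using u v by simp
  have hF: "fold R ?h z \<in> F" if "z \<in> F" for z
  proof -
    have "p (fold R ?h z) = fold (nbr X) (rev u) (fold (nbr X) u (p z0))"
      using fold_proj[OF h FD(1)[OF that]] FD(2)[OF that] eq' by simp
    also have "\<dots> = p z0"
      using X.fold_rev u proj z0 by blast
    finally show ?thesis
      using fold_closed[OF h FD(1)[OF that]] by (simp add: F_def)
  qed
  define f where "f m = (\<lambda>z\<in>F. m (fold R ?h z))" for m :: "'z \<Rightarrow> 'z"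
  have f: "f (state c) = state (?h @ c)" for c
    using hF by (auto simp: f_def state_def)
  show "\<exists>f. f \<in> ?S \<rightarrow> ?S \<and> (\<forall>i<n. \<forall>s\<in>?S. f (step i s) = step i (f s)) \<and> f s = t"
  proof (intro exI[of _ f] conjI allI impI ballI)
    have "f (state c) \<in> ?S" if "set c \<subseteq> {..<n}" for c
      unfolding f using h that by (intro imageI) simp
    then show "f \<in> ?S \<rightarrow> ?S" by blast
    show "f (step i m) = step i (f m)" if "m \<in> ?S" for i m
      using that by (auto simp: step_state f)
    show "f s = t"
      unfolding s t f using u v by (intro state_eqI) (simp add: fold_rev' fold_closed FD)
  qed
next
  let ?S = "state ` {u. set u \<subseteq> {..<n}}"
  fix s t assume "s \<in> ?S" "t \<in> ?S" and neq: "p (s z0) \<noteq> p (t z0)"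
  then obtain u v where s: "s = state u" and u: "set u \<subseteq> {..<n}"
    and t: "t = state v" and v: "set v \<subseteq> {..<n}" by blast
  have neq': "fold (nbr X) u (p z0) \<noteq> fold (nbr X) v (p z0)"
    using neq fold_proj[OF u z0(1)] fold_proj[OF v z0(1)] by (simp add: s t state_z0)
  have rv: "set (rev v) \<subseteq> {..<n}" using v by simp
  \<comment> \<open>From \<open>p z0\<close> the words \<open>u\<close> and \<open>v\<close> lead to
    different vertices. Hence undoing \<open>v\<close> after \<open>u\<close> takes \<open>F\<close>
    into another fibre, where \<open>w\<close> is trivial.\<close>
  have "state (u @ rev v @ w @ v) = state u"
  proof (rule state_eqI)
    fix z assume z: "z \<in> F"
    let ?y = "fold R (rev v) (fold R u z)"
    have y: "?y \<in> Z" using z u rv by (intro fold_closed FD)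
    have "p ?y \<noteq> p z0"
    proof
      assume "p ?y = p z0"
      then have "p (fold R v ?y) = fold (nbr X) v (p z0)"
        using fold_proj[OF v y] by simp
      moreover have "fold R v ?y = fold R u z"
        using z u v by (intro fold_rev' fold_closed FD)
      ultimately show False
        using neq' fold_proj[OF u FD(1)[OF z]] FD(2)[OF z] by simp
    qed
    then have "fold R w ?y = ?y" using w_fix y by blast
    then show "fold R (u @ rev v @ w @ v) z = fold R u z"
      using z u v by (simp add: fold_rev' fold_closed FD)
  qed
  \<comment> \<open>On the coset of \<open>v\<close> the same conjugate reduces to \<open>w\<close>
    acting on \<open>F\<close> itself, where it moves \<open>z0\<close>.\<close>
  moreover have "state (v @ rev v @ w @ v) \<noteq> state v"
  proof (rule state_neqI[OF z0_F])
    have "fold R v (fold R w z0) \<noteq> fold R v z0"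
      using fold_rev[OF v] fold_closed[OF w] z0 by metis
    then show "fold R (v @ rev v @ w @ v) z0 \<noteq> fold R v z0"
      using v z0 by (simp add: fold_rev)
  qed
  ultimately show "\<exists>u. set u \<subseteq> {..<n} \<and> fold step u s = s \<and> fold step u t \<noteq> t"
    unfolding s t using u v w by (intro exI[of _ "rev v @ w @ v"]) (simp add: fold_step)
qed

end

subsection \<open>Marking one vertex\<close>

text \<open>By the pigeonhole principle two of the first \<open>card T + 1\<close> iterates agree;
  cancelling leaves a period of at most \<open>card T\<close>, which divides
  \<open>fact m\<close>.\<close>

lemma funpow_fact_id:
  assumes "finite T" "f ` T \<subseteq> T" "inj_on f T" "card T \<le> m" "t \<in> T"
  shows "(f ^^ fact m) t = t"
proof -
  have cl: "(f ^^ a) t' \<in> T" if "t' \<in> T" for a t'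
    using that assms(2) by (induction a) auto
  have "\<not> inj_on (\<lambda>a. (f ^^ a) t) {..card T}"
  proof
    assume "inj_on (\<lambda>a. (f ^^ a) t) {..card T}"
    then have "card {..card T} \<le> card T"
      using card_inj_on_le[of "\<lambda>a. (f ^^ a) t" "{..card T}" T] cl assms by blast
    then show False by simp
  qed
  then obtain a b where ab: "a < b" "b \<le> card T" "(f ^^ a) t = (f ^^ b) t"
    unfolding inj_on_def by (metis atMost_iff linorder_neqE_nat)
  have "bij_betw f T T"
    using endo_inj_surj[OF assms(1-3)] assms(3) by (simp add: bij_betw_def)
  then have "inj_on (f ^^ a) T"
    using bij_betw_funpow bij_betw_imp_inj_on by blast
  moreover have "(f ^^ a) t = (f ^^ a) ((f ^^ (b - a)) t)"
    using ab funpow_add[of a "b - a" f] by simp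
  ultimately have per: "(f ^^ (b - a)) t = t"
    using cl assms(5) by (metis inj_onD)
  have "b - a dvd fact m"
    using ab assms(4) by (intro dvd_fact) auto
  then obtain c where "fact m = (b - a) * c" by (elim dvdE)
  moreover have "(f ^^ ((b - a) * c)) t = t"
    using per by (induction c) (auto simp: funpow_add)
  ultimately show ?thesis by simp
qed

lemma fold_concat_replicate: "fold f (concat (replicate k us)) z = (fold f us ^^ k) z"
  by (induction k arbitrary: z) (auto simp: funpow_swap1)

text \<open>An injective map of the finite set \<open>S\<close> into itself is onto
  \<open>S\<close>, so no point from outside can enter.\<close>

lemma inj_finite_avoid:
  assumes "inj_on g Z" "finite S" "S \<subseteq> Z" "g ` S \<subseteq> S" "z \<in> Z" "z \<notin> S"
  shows "g z \<notin> S"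
proof
  assume "g z \<in> S"
  moreover have "g ` S = S"
    using assms by (intro endo_inj_surj) (auto intro: inj_on_subset)
  ultimately obtain s where "s \<in> S" "g s = g z" by (metis imageE)
  then show False using assms by (metis inj_onD subsetD)
qed

datatype node = NA | NC | NE

instance node :: finite
proof
  have "(UNIV :: node set) = {NA, NC, NE}" using node.exhaust by auto
  then show "finite (UNIV :: node set)" by (metis finite.emptyI finite.insertI)
qed

text \<open>Symmetric difference with \<open>{i}\<close>: the regular action of an elementary
  abelian 2-group, in which neither a generator nor a product of two different ones has a fixed
  point.\<close>

definition flip :: "nat \<Rightarrow> nat set \<Rightarrow> nat set" where
  "flip i B = (if i \<in> B then B - {i} else insert i B)"

lemma flip_flip [simp]: "flip i (flip i B) = B"
  by (auto simp: flip_def)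

lemma flip_commute: "flip i (flip j B) = flip j (flip i B)"
  by (auto simp: flip_def)

lemma flip_neq: "flip i B \<noteq> B"
  by (auto simp: flip_def)

lemma flip_eq_flip: "flip i B = flip j B \<Longrightarrow> i = j"
  unfolding flip_def by (auto split: if_splits)

lemma flip_subset: "i < m \<Longrightarrow> B \<subseteq> {..<m} \<Longrightarrow> flip i B \<subseteq> {..<m}"
  by (auto simp: flip_def)

definition swap01 :: "int \<Rightarrow> int" where
  "swap01 d = (if d = 0 then 1 else if d = 1 then 0 else d)"

section \<open>The finite set over \<open>X\<close> and its four involutions\<close>

locale marking =
  fixes n :: nat and X :: "('d, 'v, 'x) cgraph_scheme" and x0 :: 'v
  assumes n: "n \<in> {3, 4}" and X: "premaniplex n X" and finX: "finite (verts X)"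
    and x0: "x0 \<in> verts X"
begin

text \<open>The length \<open>k\<close> is divisible by the orders of all permutations on sets of at most \<open>c\<close> points; the
  factor 800 bounds the sets in \<open>box_trivial\<close> below.\<close>

definition c :: nat where "c = 800 * card (verts X)"
definition k :: nat where "k = fact c"
text \<open>The number of positions on a cycle of nodes \<open>NA\<close>: the \<open>2 * k\<close>
  letters of \<open>alpha\<close> run around it exactly once. It is also the number of
  sheets.\<close>

definition M :: int where "M = 2 * int k"

text \<open>For \<open>n = 3\<close> the missing involution \<open>r 3\<close> is the identity.\<close>

definition r :: "nat \<Rightarrow> 'v \<Rightarrow> 'v" where
  "r i x = (if i < n then nbr X i x else x)"

lemma r: "x \<in> verts X \<Longrightarrow> r i x \<in> verts X" "x \<in> verts X \<Longrightarrow> r i (r i x) = x"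
  using involutive_action_nbr[OF X] by (auto simp: r_def involutive_action_def)

lemma r_commute:
  assumes "x \<in> verts X"
  shows "r 0 (r 2 x) = r 2 (r 0 x)" "r 0 (r 3 x) = r 3 (r 0 x)" "r 1 (r 3 x) = r 3 (r 1 x)"
  using n nbr_commute[OF X _ assms] by (auto simp: r_def far_colours_def)

lemma k_ge_2: "2 \<le> k"
proof -
  have "2 \<le> c" using finX x0 card_gt_0_iff[of "verts X"] by (auto simp: c_def)
  then have "fact 2 \<le> (fact c :: nat)" by (rule fact_mono)
  then show ?thesis by (simp add: k_def fact_2)
qed

lemma M_props: "4 \<le> M" "even M"
  using k_ge_2 by (auto simp: M_def)

text \<open>Reflections of \<open>\<int>/M\<close>, represented by \<open>{0..<M}\<close>: \<open>i \<mapsto> 1 - i\<close>, \<open>i \<mapsto> -1 - i\<close> and \<open>d \<mapsto> -d\<close>.\<close>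

definition rho1 :: "int \<Rightarrow> int" where "rho1 i = (if i \<le> 1 then 1 - i else M + 1 - i)"
definition rho2 :: "int \<Rightarrow> int" where "rho2 i = M - 1 - i"
definition neg :: "int \<Rightarrow> int" where "neg d = (if d = 0 then 0 else M - d)"

text \<open>On side \<open>False\<close> the marked edge joins position 0 over \<open>x0\<close> to
  position 1 over \<open>r 1 x0\<close>. Both ends carry the mark, which keeps \<open>R1\<close> an
  involution.\<close>

definition mark :: "'v \<Rightarrow> int \<Rightarrow> bool \<Rightarrow> bool" where
  "mark x i j \<longleftrightarrow> (i = 0 \<and> (if j then r 3 x else x) = x0)
     \<or> (i = 1 \<and> (if j then r 3 (r 1 x) else r 1 x) = x0)"

text \<open>A point is a vertex \<open>x\<close>, a node with a position \<open>i\<close>, a sheet \<open>d\<close>, a side \<open>j\<close> and a set \<open>B\<close> of colours.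
  On side \<open>False\<close> the nodes \<open>NA\<close> form cycles under \<open>R1\<close> and \<open>R2\<close>, and crossing the marked edge of
  such a cycle swaps the sheets 0 and 1. The path \<open>R0\<close>, \<open>R1\<close>, \<open>R2\<close> leads from position 0 of such a cycle,
  but from no other position, to \<open>(NE, M - 1)\<close>, where \<open>R0\<close> and \<open>R1\<close> rotate the sheets.
  As \<open>R3\<close> has to commute with \<open>R1\<close>, it carries the mark to the side \<open>True\<close>. There \<open>R2\<close>, which need
  not commute with \<open>R3\<close>, fixes the position, so that no long cycles arise. The set \<open>B\<close> only
  serves to avoid fixed points.\<close>

type_synonym 'a point = "'a \<times> (node \<times> int) \<times> int \<times> bool \<times> nat set"

fun R0 :: "'v point \<Rightarrow> 'v point" where
  "R0 (x, (v, i), d, j, B) =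
     (r 0 x, (case v of NA \<Rightarrow> NC | NC \<Rightarrow> NA | NE \<Rightarrow> NE, i), if v = NE then neg d else d, j, flip 0 B)"

fun R1 :: "'v point \<Rightarrow> 'v point" where
  "R1 (x, (NA, i), d, j, B) = (r 1 x, (NA, rho1 i), if mark x i j then swap01 d else d, j, flip 1 B)"
| "R1 (x, (NC, i), d, j, B) = (r 1 x, (if even i then NE else NC, i), d, j, flip 1 B)"
| "R1 (x, (NE, i), d, j, B) =
     (r 1 x, (if even i then NC else NE, i), if i = M - 1 then rho1 d else d, j, flip 1 B)"

fun R2 :: "'v point \<Rightarrow> 'v point" where
  "R2 (x, (v, i), d, j, B) = (r 2 x, (v, if j then i else rho2 i), d, j, flip 2 B)"

fun R3 :: "'v point \<Rightarrow> 'v point" where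
  "R3 (x, v, d, j, B) = (r 3 x, v, d, \<not> j, flip 3 B)"

definition R :: "nat \<Rightarrow> 'v point \<Rightarrow> 'v point" where
  "R i = (if i = 0 then R0 else if i = 1 then R1 else if i = 2 then R2 else R3)"

lemma R_simps [simp]: "R 0 = R0" "R 1 = R1" "R (Suc 0) = R1" "R 2 = R2" "R 3 = R3"
  by (simp_all add: R_def)

definition Z :: "'v point set" where
  "Z = verts X \<times> (UNIV \<times> {0..<M}) \<times> {0..<M} \<times> UNIV \<times> Pow {..<4}"

lemma less4: "i < 4 \<longleftrightarrow> i = 0 \<or> i = 1 \<or> i = 2 \<or> i = (3 :: nat)"
  by auto

lemma R_closed:
  assumes "i < 4" "z \<in> Z"
  shows "R i z \<in> Z"
proof -
  obtain x v q d j B where z: "z = (x, (v, q), d, j, B)" by (metis prod.collapse)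
  show ?thesis
    using assms M_props unfolding less4 Z_def z
    by (cases v) (auto simp: r rho1_def rho2_def neg_def swap01_def flip_subset
        simp del: Pow_iff dest: flip_subset[of _ 4] simp: Pow_iff[abs_def])
qed

lemma R_invol:
  assumes "i < 4" "z \<in> Z"
  shows "R i (R i z) = z"
proof -
  obtain x v q d j B where z: "z = (x, (v, q), d, j, B)" by (metis prod.collapse)
  show ?thesis
    using assms M_props r_commute unfolding less4 Z_def z
    by (cases v) (auto simp: r rho1_def rho2_def neg_def swap01_def mark_def)
qed

sublocale Z: involutive_action 4 Z R
  by unfold_locales (auto simp: R_closed R_invol)

lemma R_commute:
  assumes "z \<in> Z"
  shows "R0 (R2 z) = R2 (R0 z)" "R0 (R3 z) = R3 (R0 z)" "R1 (R3 z) = R3 (R1 z)"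
proof -
  obtain x v q d j B where z: "z = (x, (v, q), d, j, B)" by (metis prod.collapse)
  then have x: "x \<in> verts X" using assms by (simp add: Z_def)
  show "R0 (R2 z) = R2 (R0 z)" "R0 (R3 z) = R3 (R0 z)"
    unfolding z by (cases v; auto simp: r_commute x flip_commute)+
  \<comment> \<open>Changing sides replaces \<open>x\<close> by \<open>r 3 x\<close> in the mark; at
    position 1 this uses that \<open>r 1\<close> and \<open>r 3\<close> commute.\<close>
  have "mark (r 3 x) q (\<not> j) = mark x q j"
    using x by (auto simp: mark_def r r_commute simp del: One_nat_def)
  then show "R1 (R3 z) = R3 (R1 z)"
    unfolding z by (cases v; auto simp: r_commute x flip_commute simp del: One_nat_def)
qed

section \<open>The two elements and their commutator\<close>

definition alpha :: "nat list" where "alpha = concat (replicate k [1, 2])"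
definition beta :: "nat list" where "beta = concat (replicate k [0, 1])"

text \<open>The conjugate of \<open>beta\<close> by the path that takes position 0 of a cycle to the
  place where \<open>beta\<close> rotates the sheets.\<close>

definition gamma :: "nat list" where
  "gamma = [0, 1, 2] @ beta @ [2, 1, 0]"

definition word :: "nat list" where
  "word = alpha @ gamma @ rev alpha @ rev gamma"

lemma k_period:
  assumes "finite T" "f ` T \<subseteq> T" "inj_on f T" "card T \<le> c" "t \<in> T"
  shows "(f ^^ k) t = t"
  unfolding k_def by (rule funpow_fact_id[OF assms])

definition box where
  "box N D j = verts X \<times> N \<times> D \<times> {j} \<times> Pow {..<4 :: nat}" for N :: "(node \<times> int) set" and D :: "int set" and j :: bool

text \<open>A box has at most \<open>5 * 5 * 16\<close> points for each vertex of \<open>X\<close>,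
  so the order of the permutation induced on it divides \<open>k\<close>. Showing that a word is
  trivial at a point thus amounts to finding a small closed box around it.\<close>

lemma box_trivial:
  assumes ij: "i < 4" "j < 4"
    and N: "finite N" "card N \<le> 5" "N \<subseteq> UNIV \<times> {0..<M}"
    and D: "finite D" "card D \<le> 5" "D \<subseteq> {0..<M}"
    and cl: "\<And>z. z \<in> box N D b \<Longrightarrow> R i z \<in> box N D b \<and> R j z \<in> box N D b"
    and z: "z \<in> box N D b"
  shows "fold R (concat (replicate k [i, j])) z = z"
proof -
  let ?T = "box N D b" and ?f = "fold R [i, j]"
  have TZ: "?T \<subseteq> Z"
    using N(3) D(3) by (auto simp: box_def Z_def)
  have "(?f ^^ k) z = z"
  proof (rule k_period[of ?T])
    show "finite ?T" using N D finX by (auto simp: box_def)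
    have "?f z \<in> ?T" if "z \<in> ?T" for z
      using cl[OF conjunct1[OF cl[OF that]]] by simp
    then show "?f ` ?T \<subseteq> ?T" by blast
    show "inj_on ?f ?T"
    proof (rule inj_on_inverseI)
      fix z assume "z \<in> ?T"
      then show "fold R (rev [i, j]) (?f z) = z"
        using TZ ij by (intro Z.fold_rev) auto
    qed
    have "card ?T = card (verts X) * (card N * (card D * 16))"
      by (simp add: box_def card_cartesian_product card_Pow)
    also have "\<dots> \<le> card (verts X) * (5 * (5 * 16))"
      using N(2) D(2) by (intro mult_mono) auto
    also have "\<dots> \<le> c" by (simp add: c_def)
    finally show "card ?T \<le> c" .
  qed (rule z)
  then show ?thesis by (simp add: fold_concat_replicate)
qed

section \<open>Where \<open>alpha\<close> and \<open>beta\<close> act trivially\<close>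

lemma rho_range:
  "i \<in> {0..<M} \<Longrightarrow> rho1 i \<in> {0..<M}" "i \<in> {0..<M} \<Longrightarrow> rho2 i \<in> {0..<M}"
  "i \<in> {0..<M} \<Longrightarrow> neg i \<in> {0..<M}"
  "i \<in> {0..<M} \<Longrightarrow> rho1 (rho1 i) = i" "rho2 (rho2 i) = i" "i \<in> {0..<M} \<Longrightarrow> neg (neg i) = i"
  "even (rho1 i) \<longleftrightarrow> odd i" "even (rho2 i) \<longleftrightarrow> odd i" "rho1 0 = 1" "rho1 1 = 0" "neg 0 = 0"
  "neg 1 = M - 1" "neg (M - 1) = 1" "swap01 0 = 1" "swap01 1 = 0"
  using M_props by (auto simp: rho1_def rho2_def neg_def swap01_def)

lemma card_le5: "card {x1} \<le> 5" "card {x1, x2} \<le> 5" "card {x1, x2, x3} \<le> 5"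
  "card {x1, x2, x3, x4} \<le> 5" "card {x1, x2, x3, x4, x5} \<le> 5"
  by (auto simp: card_insert_if)

definition V :: "int \<Rightarrow> 'v point set" where
  "V i = {(x, (NA, i), d, False, B) | x d B. x \<in> verts X \<and> d \<in> {0..<M} \<and> B \<subseteq> {..<4}}"

lemma Z_cases:
  assumes "z \<in> Z"
  obtains x v q d j B where "z = (x, (v, q), d, j, B)" "x \<in> verts X" "q \<in> {0..<M}" "d \<in> {0..<M}" "B \<subseteq> {..<4}"
  using assms by (auto simp: Z_def)

text \<open>Off the long cycles at most one of \<open>R1\<close> and \<open>R2\<close> changes the
  position, and the sheets stay in a small set: \<open>rho1\<close> acts on them at
  \<open>NE\<close>, \<open>swap01\<close> at \<open>NA\<close>.\<close>

lemma alpha_trivial: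
  assumes "z \<in> Z" "\<And>i. i \<in> {0..<M} \<Longrightarrow> z \<notin> V i"
  shows "fold R alpha z = z"
proof -
  obtain x v q d j B where z: "z = (x, (v, q), d, j, B)" "x \<in> verts X" "q \<in> {0..<M}" "d \<in> {0..<M}" "B \<subseteq> {..<4}"
    by (rule Z_cases[OF assms(1)])
  have "\<not> (v = NA \<and> \<not> j)"
    using assms(2)[OF z(3)] z by (auto simp: V_def)
  then consider "v \<in> {NC, NE}" "\<not> j" | "v \<in> {NC, NE}" j | "v = NA" j
    by (cases v) auto
  then show ?thesis
  proof cases
    case 1
    show ?thesis
      unfolding alpha_def
    proof (rule box_trivial[of _ _ "{(NC, q), (NE, q), (NC, rho2 q), (NE, rho2 q)}" "{d, rho1 d}" False])
      fix y assume "y \<in> box {(NC, q), (NE, q), (NC, rho2 q), (NE, rho2 q)} {d, rho1 d} False"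
      then show "R 1 y \<in> box {(NC, q), (NE, q), (NC, rho2 q), (NE, rho2 q)} {d, rho1 d} False
        \<and> R 2 y \<in> box {(NC, q), (NE, q), (NC, rho2 q), (NE, rho2 q)} {d, rho1 d} False"
        using z by (auto simp: box_def r rho_range flip_subset)
    qed (use 1 z M_props rho_range in \<open>auto simp: box_def card_le5\<close>)
  next
    case 2
    show ?thesis
      unfolding alpha_def
    proof (rule box_trivial[of _ _ "{(NC, q), (NE, q)}" "{d, rho1 d}" True])
      fix y assume "y \<in> box {(NC, q), (NE, q)} {d, rho1 d} True"
      then show "R 1 y \<in> box {(NC, q), (NE, q)} {d, rho1 d} True
        \<and> R 2 y \<in> box {(NC, q), (NE, q)} {d, rho1 d} True"
        using z by (auto simp: box_def r rho_range flip_subset)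
    qed (use 2 z M_props rho_range in \<open>auto simp: box_def card_le5\<close>)
  next
    case 3
    show ?thesis
      unfolding alpha_def
    proof (rule box_trivial[of _ _ "{(NA, q), (NA, rho1 q)}" "{d, 0, 1}" True])
      fix y assume "y \<in> box {(NA, q), (NA, rho1 q)} {d, 0, 1} True"
      then show "R 1 y \<in> box {(NA, q), (NA, rho1 q)} {d, 0, 1} True
        \<and> R 2 y \<in> box {(NA, q), (NA, rho1 q)} {d, 0, 1} True"
        using z by (auto simp: box_def r rho_range flip_subset swap01_def)
    qed (use 3 z M_props rho_range in \<open>auto simp: box_def card_le5\<close>)
  qed
qed

text \<open>At such an odd position \<open>R1\<close> fixes both node and sheet, so only
  \<open>neg\<close> acts on the sheets.\<close>

lemma beta_trivial_NE:
  assumes "x \<in> verts X" "q \<in> {0..<M}" "d \<in> {0..<M}" "B \<subseteq> {..<4}" "odd q" "q \<noteq> M - 1"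
  shows "fold R beta (x, (NE, q), d, j, B) = (x, (NE, q), d, j, B)"
  unfolding beta_def
proof (rule box_trivial[of _ _ "{(NE, q)}" "{d, neg d}" j])
  fix y assume "y \<in> box {(NE, q)} {d, neg d} j"
  then show "R 0 y \<in> box {(NE, q)} {d, neg d} j \<and> R 1 y \<in> box {(NE, q)} {d, neg d} j"
    using assms by (auto simp: box_def r rho_range flip_subset)
qed (use assms M_props rho_range in \<open>auto simp: box_def card_le5\<close>)

lemma beta_trivial_NC:
  assumes "x \<in> verts X" "q \<in> {0..<M}" "d \<in> {0..<M}" "B \<subseteq> {..<4}" "even q"
  shows "fold R beta (x, (NC, q), d, j, B) = (x, (NC, q), d, j, B)"
proof -
  \<comment> \<open>The five nodes form, in this order, a path whose edges belong alternately to
    \<open>R1\<close> and \<open>R0\<close>; both ends are fixed nodes, the last because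
    \<open>rho1 q\<close> is odd. The sheets are closed under \<open>neg\<close> and
    \<open>swap01\<close>; \<open>rho1\<close> does not act on them, as \<open>q\<close> is
    even.\<close>
  let ?N = "{(NE, q), (NC, q), (NA, q), (NA, rho1 q), (NC, rho1 q)}" and ?D = "{d, neg d, 0, 1, M - 1}"
  have q: "q \<noteq> M - 1" using assms M_props by auto
  define D where "D = ?D"
  have D: "swap01 d' \<in> D" "neg d' \<in> D" if "d' \<in> D" for d'
    using that assms M_props by (auto simp: D_def swap01_def rho_range)
  have "D \<subseteq> {0..<M}" "card D \<le> 5" "finite D"
    unfolding D_def using assms M_props rho_range(3) by (auto intro: card_le5)
  show ?thesis
    unfolding beta_def
  proof (rule box_trivial[of _ _ ?N D j])
    fix y assume "y \<in> box ?N D j"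
    then obtain x' v q' d' B' where y: "y = (x', (v, q'), d', j, B')"
      and y': "x' \<in> verts X" "d' \<in> D" "B' \<subseteq> {..<4}" and "(v, q') \<in> ?N"
      by (auto simp: box_def)
    then consider "v = NE" "q' = q" | "v = NC" "q' = q" | "v = NA" "q' = q" | "v = NA" "q' = rho1 q"
      | "v = NC" "q' = rho1 q"
      by blast
    then show "R 0 y \<in> box ?N D j \<and> R 1 y \<in> box ?N D j"
      by cases (use y' q D assms in \<open>simp_all add: y box_def r rho_range flip_subset\<close>)
  next
    show "card ?N \<le> 5" by (rule card_le5)
    show "?N \<subseteq> UNIV \<times> {0..<M}"
      using assms rho_range(1) by auto
    show "(x, (NC, q), d, j, B) \<in> box ?N D j"
      using assms by (simp add: box_def D_def)
  qed (simp_all add: \<open>D \<subseteq> {0..<M}\<close> \<open>card D \<le> 5\<close> \<open>finite D\<close>)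
qed

section \<open>Action on the long cycles\<close>

lemma nbr_period: "i < 4 \<Longrightarrow> j < 4 \<Longrightarrow> x \<in> verts X \<Longrightarrow> ((\<lambda>x. r j (r i x)) ^^ k) x = x"
  by (rule k_period[OF finX]) (auto simp: r c_def intro!: inj_on_inverseI[of _ "\<lambda>x. r i (r j x)"])

lemma flip_period:
  assumes "i < 4" "j < 4" "B \<subseteq> {..<4}"
  shows "((\<lambda>B. flip j (flip i B)) ^^ k) B = B"
proof (rule k_period[of "Pow {..<4}"])
  have "flip j (flip i B) \<subseteq> {..<4}" if "B \<subseteq> {..<4}" for B
    using that assms by (intro flip_subset)
  then show "(\<lambda>B. flip j (flip i B)) ` Pow {..<4} \<subseteq> Pow {..<4}" by blast
  have "card (verts X) > 0" using finX x0 card_gt_0_iff by blast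
  then show "card (Pow {..<4 :: nat}) \<le> c" by (simp add: card_Pow c_def)
qed (use assms in \<open>auto intro!: inj_on_inverseI[of _ "\<lambda>B. flip i (flip j B)"]\<close>)

text \<open>As \<open>M - 1\<close> is odd, \<open>R0\<close> and \<open>R1\<close> stay at this
  node. On the sheets they are two reflections whose composite is translation by 1.\<close>

lemma beta_shift:
  assumes "x \<in> verts X" "d \<in> {0..<M}" "B \<subseteq> {..<4}"
  shows "fold R beta (x, (NE, M - 1), d, j, B) = (x, (NE, M - 1), (d + int k) mod M, j, B)"
proof -
  define f where "f = fold R [0, 1]"
  have step: "f (x, (NE, M - 1), d, j, B) = (r 1 (r 0 x), (NE, M - 1), (d + 1) mod M, j, flip 1 (flip 0 B))"
    if "d \<in> {0..<M}" for x d B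
  proof -
    have "rho1 (neg d) = (d + 1) mod M"
      using that M_props by (cases "d = M - 1") (auto simp: rho1_def neg_def)
    then show ?thesis using M_props by (simp add: f_def)
  qed
  have "(f ^^ t) (x, (NE, M - 1), d, j, B)
      = (((\<lambda>x. r 1 (r 0 x)) ^^ t) x, (NE, M - 1), (d + int t) mod M, j, ((\<lambda>B. flip 1 (flip 0 B)) ^^ t) B)" for t
  proof (induction t)
    case (Suc t)
    let ?x = "((\<lambda>x. r 1 (r 0 x)) ^^ t) x" and ?B = "((\<lambda>B. flip 1 (flip 0 B)) ^^ t) B"
    have "(f ^^ Suc t) (x, (NE, M - 1), d, j, B) = f (?x, (NE, M - 1), (d + int t) mod M, j, ?B)"
      using Suc by simp
    also have "\<dots> = (r 1 (r 0 ?x), (NE, M - 1), ((d + int t) mod M + 1) mod M, j, flip 1 (flip 0 ?B))"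
      using M_props by (intro step) simp
    also have "((d + int t) mod M + 1) mod M = (d + int (Suc t)) mod M"
      unfolding mod_add_left_eq by (simp add: ac_simps)
    finally show ?case by simp
  qed (use assms in simp)
  from this[of k] show ?thesis
    using assms nbr_period[of 0 1 x] flip_period[of 0 1 B] 
    unfolding beta_def fold_concat_replicate f_def[symmetric] by simp
qed

text \<open>\<open>rho1\<close> followed by \<open>rho2\<close> is translation by -2, so
  \<open>k\<close> rounds return to position 0. The edge that may be marked is crossed in the first
  round only.\<close>

lemma alpha_V0:
  assumes "x \<in> verts X" "B \<subseteq> {..<4}"
  shows "fold R alpha (x, (NA, 0), d, False, B) = (x, (NA, 0), if x = x0 then swap01 d else d, False, B)"
proof -
  define f where "f = fold R [1, 2]"
  let ?d = "if x = x0 then swap01 d else d"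
  \<comment> \<open>The count starts after the first round, which accounts for the mark; every later
    round starts at a position of at least 2, where there is none. For \<open>t = k - 1\<close> the
    position is 0 again.\<close>
  have "(f ^^ Suc t) (x, (NA, 0), d, False, B)
      = (((\<lambda>x. r 2 (r 1 x)) ^^ Suc t) x, (NA, M - 2 - 2 * int t), ?d, False, ((\<lambda>B. flip 2 (flip 1 B)) ^^ Suc t) B)"
    if "t < k" for t
    using that
  proof (induction t)
    case 0
    then show ?case by (auto simp: f_def mark_def rho1_def rho2_def)
  next
    case (Suc t)
    let ?q = "M - 2 - 2 * int t"
    let ?x = "((\<lambda>x. r 2 (r 1 x)) ^^ Suc t) x" and ?B = "((\<lambda>B. flip 2 (flip 1 B)) ^^ Suc t) B"
    have "2 \<le> ?q" using Suc.prems by (simp add: M_def)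
    then have step: "f (x', (NA, ?q), d', False, B')
      = (r 2 (r 1 x'), (NA, M - 2 - 2 * int (Suc t)), d', False, flip 2 (flip 1 B'))" for x' d' B'
      by (simp add: f_def mark_def rho1_def rho2_def)
    have "(f ^^ Suc (Suc t)) (x, (NA, 0), d, False, B) = f ((f ^^ Suc t) (x, (NA, 0), d, False, B))"
      by simp
    also have "(f ^^ Suc t) (x, (NA, 0), d, False, B) = (?x, (NA, ?q), ?d, False, ?B)"
      using Suc by simp
    finally show ?case
      unfolding step by simp
  qed
  from this[of "k - 1"] have "(f ^^ k) (x, (NA, 0), d, False, B)
      = (((\<lambda>x. r 2 (r 1 x)) ^^ k) x, (NA, 0), ?d, False, ((\<lambda>B. flip 2 (flip 1 B)) ^^ k) B)"
    using k_ge_2 by (simp add: M_def of_nat_diff)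
  then show ?thesis
    using assms nbr_period[of 1 2 x] flip_period[of 1 2 B] 
    unfolding alpha_def fold_concat_replicate f_def[symmetric] by simp
qed

text \<open>The path ends at \<open>NE\<close> with odd position if \<open>q\<close> is even, and at
  \<open>NC\<close> with even position if \<open>q\<close> is odd. There \<open>beta\<close> is
  trivial unless \<open>rho2 q = M - 1\<close>, that is, \<open>q = 0\<close>.\<close>

lemma gamma_V:
  assumes "x \<in> verts X" "q \<in> {0..<M}" "d \<in> {0..<M}" "B \<subseteq> {..<4}"
  shows "fold R gamma (x, (NA, q), d, False, B)
    = (x, (NA, q), if q = 0 then (d + int k) mod M else d, False, B)"
proof -
  let ?x = "r 2 (r 1 (r 0 x))" and ?B = "flip 2 (flip 1 (flip 0 B))"
    and ?v = "if even q then NE else NC" and ?d = "if q = 0 then (d + int k) mod M else d"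
  have x: "?x \<in> verts X" and B: "?B \<subseteq> {..<4}"
    using assms r flip_subset by simp_all
  have "fold R [0, 1, 2] (x, (NA, q), d, False, B) = (?x, (?v, rho2 q), d, False, ?B)"
    by simp
  moreover have "fold R beta (?x, (?v, rho2 q), d, False, ?B) = (?x, (?v, rho2 q), ?d, False, ?B)"
  proof (cases "even q")
    case True
    show ?thesis
    proof (cases "q = 0")
      case True
      then show ?thesis using beta_shift[OF x assms(3) B] by (simp add: rho2_def)
    next
      case False
      then have "rho2 q \<noteq> M - 1" by (simp add: rho2_def)
      then show ?thesis
        using True False beta_trivial_NE[OF x rho_range(2)[OF assms(2)] assms(3) B] rho_range(8)[of q] by simp
    qed
  next
    case False
    then have "q \<noteq> 0" by auto
    then show ?thesis
      using False beta_trivial_NC[OF x rho_range(2)[OF assms(2)] assms(3) B] rho_range(8)[of q] by simp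
  qed
  moreover have "fold R [2, 1, 0] (?x, (?v, rho2 q), ?d, False, ?B) = (x, (NA, q), ?d, False, B)"
  proof -
    \<comment> \<open>On the way back \<open>R1\<close> meets \<open>NE\<close> only at even
      positions, so it leaves the sheet unchanged.\<close>
    have "even q \<Longrightarrow> q \<noteq> M - 1" using M_props by auto
    moreover have "M \<noteq> 1" using M_props by simp
    ultimately show ?thesis
      using assms(1) by (simp add: r rho_range)
  qed
  ultimately show ?thesis
    unfolding gamma_def fold_append o_apply by simp
qed

section \<open>Effect of the commutator\<close>

lemma word_colours: "set alpha \<subseteq> {1, 2}" "set gamma \<subseteq> {0, 1, 2}" "set word \<subseteq> {0, 1, 2}"
  by (auto simp: alpha_def beta_def gamma_def word_def)

lemma word_colours4: "set alpha \<subseteq> {..<4}" "set gamma \<subseteq> {..<4}"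
  "set (rev alpha) \<subseteq> {..<4}" "set (rev gamma) \<subseteq> {..<4}"
  using word_colours by auto

lemma fold_word: "fold R word z = fold R (rev gamma) (fold R (rev alpha) (fold R gamma (fold R alpha z)))"
  by (simp only: word_def fold_append o_apply)

lemma V_Z: "i \<in> {0..<M} \<Longrightarrow> V i \<subseteq> Z"
  by (auto simp: V_def Z_def)

lemma finite_Z: "finite Z"
  using finX by (simp add: Z_def)

lemma inj_fold: "set u \<subseteq> {..<4} \<Longrightarrow> inj_on (fold R u) Z"
  by (rule inj_on_inverseI[of _ "fold R (rev u)"]) (rule Z.fold_rev)

lemma alpha_V_closed:
  assumes "z \<in> (\<Union>i\<in>{0..<M}. V i)"
  shows "fold R alpha z \<in> (\<Union>i\<in>{0..<M}. V i)"
proof -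
  define VV where "VV = (\<Union>i\<in>{0..<M}. V i)"
  have "R 1 z \<in> VV" "R 2 z \<in> VV"
    if z: "z \<in> VV" for z
  proof -
    obtain x i d B where z: "z = (x, (NA, i), d, False, B)" "x \<in> verts X" "i \<in> {0..<M}"
      "d \<in> {0..<M}" "B \<subseteq> {..<4}"
      using z by (auto simp: VV_def V_def)
    have "R 1 z \<in> V (rho1 i)" "R 2 z \<in> V (rho2 i)"
      using z M_props by (auto simp: V_def r swap01_def flip_subset)
    then show "R 1 z \<in> VV" "R 2 z \<in> VV"
      using rho_range(1,2)[OF z(3)] unfolding VV_def by blast+
  qed
  then have step: "R i z \<in> VV" if "i \<in> {1, 2}" "z \<in> VV" for i z
    using that by blast
  have "fold R u z \<in> VV" if "set u \<subseteq> {1, 2}" "z \<in> VV" for u z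
    using that by (induction u arbitrary: z) (simp_all add: step)
  then show ?thesis
    using word_colours(1) assms unfolding VV_def by blast
qed

lemma V_cases:
  assumes "z \<in> V i"
  obtains x d B where "z = (x, (NA, i), d, False, B)" "x \<in> verts X" "d \<in> {0..<M}" "B \<subseteq> {..<4}"
  using assms by (auto simp: V_def)

lemma gamma_V_closed: "i \<in> {0..<M} \<Longrightarrow> z \<in> V i \<Longrightarrow> fold R gamma z \<in> V i"
  using M_props by (elim V_cases) (auto simp: gamma_V V_def)

lemma alpha_V0_closed: "z \<in> V 0 \<Longrightarrow> fold R alpha z \<in> V 0"
  using M_props by (elim V_cases) (auto simp: alpha_V0 V_def swap01_def)

text \<open>The commutator fixes \<open>z\<close> if \<open>alpha\<close> fixes \<open>z\<close> and
  its image under \<open>gamma\<close>, or if \<open>gamma\<close> fixes \<open>z\<close> and its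
  image under \<open>alpha\<close>. The first happens off the long cycles and at position 0 over
  vertices other than \<open>x0\<close>, the second at all other positions.\<close>

lemma word_fix:
  assumes z: "z \<in> Z" and x: "fst z \<noteq> x0"
  shows "fold R word z = z"
proof -
  let ?VV = "\<Union>i\<in>{0..<M}. V i"
  have VV: "finite ?VV" "?VV \<subseteq> Z" and V0: "finite (V 0)" "V 0 \<subseteq> Z"
  proof -
    show "?VV \<subseteq> Z" "V 0 \<subseteq> Z" using V_Z M_props by (blast, simp)
    then show "finite ?VV" "finite (V 0)" using finite_subset finite_Z by blast+
  qed
  have inv: "fold R (rev alpha) (fold R alpha y) = y" "fold R (rev gamma) (fold R gamma y) = y"
    if "y \<in> Z" for y
    using that Z.fold_rev word_colours4 by blast+
  consider "z \<notin> ?VV" | "z \<in> V 0" | i where "z \<in> V i" "i \<in> {0..<M}" "i \<noteq> 0"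
    by blast
  then show ?thesis
  proof cases
    case 1
    have "fold R gamma ` ?VV \<subseteq> ?VV" using gamma_V_closed by blast
    then have g: "fold R gamma z \<notin> ?VV"
      using inj_finite_avoid[OF inj_fold[OF word_colours4(2)] VV _ z 1] by blast
    have gZ: "fold R gamma z \<in> Z" using Z.fold_closed z word_colours4 by blast
    have "fold R alpha z = z" "fold R alpha (fold R gamma z) = fold R gamma z"
      using alpha_trivial[OF z] alpha_trivial[OF gZ] 1 g by blast+
    then show ?thesis
      unfolding fold_word using inv(1)[OF gZ] inv(2)[OF z] by simp
  next
    case 2
    then obtain x d B where z': "z = (x, (NA, 0), d, False, B)" "x \<in> verts X" "d \<in> {0..<M}" "B \<subseteq> {..<4}"
      by (rule V_cases)
    then have neq: "x \<noteq> x0" using x by simp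
    have gZ: "fold R gamma z \<in> Z" using Z.fold_closed z word_colours4 by blast
    have "fold R gamma z = (x, (NA, 0), (d + int k) mod M, False, B)"
      using gamma_V[OF z'(2) _ z'(3,4), of 0] z'(1) M_props by simp
    then have "fold R alpha z = z" "fold R alpha (fold R gamma z) = fold R gamma z"
      using neq z' alpha_V0 by simp_all
    then show ?thesis
      unfolding fold_word using inv(1)[OF gZ] inv(2)[OF z] by simp
  next
    case 3
    have g: "fold R gamma y = y" if "y \<in> V i" "i \<in> {0..<M}" "i \<noteq> 0" for y i
      using that by (elim V_cases) (simp add: gamma_V)
    have aZ: "fold R alpha z \<in> Z" using Z.fold_closed z word_colours4 by blast
    have "z \<notin> V 0" using 3 by (auto simp: V_def)
    moreover have "fold R alpha ` V 0 \<subseteq> V 0" using alpha_V0_closed by blast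
    \<comment> \<open>\<open>alpha\<close> permutes \<open>V 0\<close>, so it cannot bring
      \<open>z\<close> to the only position at which \<open>gamma\<close> acts.\<close>
    ultimately have "fold R alpha z \<notin> V 0"
      using inj_finite_avoid[OF inj_fold[OF word_colours4(1)] V0 _ z] by blast
    then obtain i' where "fold R alpha z \<in> V i'" "i' \<in> {0..<M}" "i' \<noteq> 0"
      using alpha_V_closed 3 by blast
    then have "fold R gamma (fold R alpha z) = fold R alpha z" "fold R gamma z = z"
      using g 3 by blast+
    then show ?thesis
      unfolding fold_word using inv(1)[OF z] inv(2)[OF z] by simp
  qed
qed

definition base :: "'v point" where "base = (x0, (NA, 0), 0, False, {})"

lemma base_Z: "base \<in> Z"
  using x0 M_props by (simp add: base_def Z_def)

text \<open>The sheet runs through 0, 1, \<open>1 + k\<close>, \<open>1 + k\<close>, 1: both letters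
  of the transposition are avoided by \<open>1 + k\<close>, and \<open>k \<ge> 2\<close> gives
  \<open>1 + k < M\<close>.\<close>

lemma word_base: "fold R word base \<noteq> base"
proof -
  let ?z = "\<lambda>d. (x0, (NA, 0), d, False, {})"
  have zZ: "?z d \<in> Z" if "d \<in> {0..<M}" for d
    using that x0 M_props by (simp add: Z_def)
  have d: "0 \<in> {0..<M}" "1 \<in> {0..<M}" "1 + int k \<in> {0..<M}" "(1 + int k) mod M = 1 + int k"
    using k_ge_2 by (simp_all add: M_def)
  have a: "fold R alpha (?z d) = ?z (swap01 d)" for d
    using alpha_V0[OF x0] by simp
  have g: "fold R gamma (?z d) = ?z ((d + int k) mod M)" if "d \<in> {0..<M}" for d
    using gamma_V[OF x0 d(1) that] by simp
  have 1: "fold R alpha base = ?z 1"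
    using a[of 0] by (simp add: base_def rho_range)
  have 2: "fold R gamma (?z 1) = ?z (1 + int k)"
    using g[OF d(2)] d(4) by simp
  have "fold R alpha (?z (1 + int k)) = ?z (1 + int k)"
    using a k_ge_2 by (simp add: swap01_def)
  then have 3: "fold R (rev alpha) (?z (1 + int k)) = ?z (1 + int k)"
    using Z.fold_rev[OF word_colours4(1) zZ[OF d(3)]] by simp
  have 4: "fold R (rev gamma) (?z (1 + int k)) = ?z 1"
    using Z.fold_rev[OF word_colours4(2) zZ[OF d(2)]] 2 by simp
  show ?thesis
    unfolding fold_word 1 2 3 4 by (simp add: base_def)
qed

lemma R_bits:
  assumes "i < 4"
  shows "snd (snd (snd (snd (R i z)))) = flip i (snd (snd (snd (snd z))))"
  using assms by (cases z rule: R1.cases) (auto simp: less4)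

text \<open>Freeness is read off from the sets \<open>B\<close>. Since \<open>word\<close> uses only
  the colours 0, 1 and 2, it serves both ranks.\<close>

lemma marked_action: "marked_action n Z R X fst word base"
proof (intro marked_action.intro involutive_action.intro marked_action_axioms.intro)
  have n4: "i < n \<Longrightarrow> i < 4" for i using n by auto
  have bits: "snd (snd (snd (snd (R i z)))) = flip i (snd (snd (snd (snd z))))" if "i < n" for i z
    using R_bits n4[OF that] .
  show "premaniplex n X" by (rule X)
  show "finite Z" by (rule finite_Z)
  show "set word \<subseteq> {..<n}" using word_colours(3) n by auto
  show "base \<in> Z" "fold R word base \<noteq> base" by (rule base_Z word_base)+
  fix z assume z: "z \<in> Z"
  show "fst z \<in> verts X" using z by (auto simp: Z_def)
  show "fold R word z = z" if "fst z \<noteq> fst base"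
    using that word_fix[OF z] by (simp add: base_def)
  fix i assume i: "i < n"
  show "R i z \<in> Z" "R i (R i z) = z" using R_closed R_invol n4[OF i] z by blast+
  show "R i z \<noteq> z" using bits[OF i, of z] flip_neq by metis
  have "fst (R i z) = r i (fst z)"
    using n4[OF i] by (cases z rule: R1.cases) (auto simp: less4)
  then show "fst (R i z) = nbr X i (fst z)" using i by (simp add: r_def)
next
  fix i j z assume "i < n" "j < n" "R i z = R j z"
  moreover have "i < 4" "j < 4" using calculation n by auto
  ultimately show "i = j" using flip_eq_flip R_bits by metis
next
  fix i j z assume far: "far_colours n i j" and z: "z \<in> Z"
  then have "(i, j) \<in> {(0, 2), (2, 0), (0, 3), (3, 0), (1, 3), (3, 1)}"
    using n by (auto simp: far_colours_def)
  then show "R i (R j z) = R j (R i z)"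
    using R_commute[OF z] by auto
qed

end

theorem theorem1p2:
  fixes X :: "('d, 'v) cgraph" and n :: nat
  assumes "n \<in> {3, 4}" and "premaniplex n X" and "finite_graph X"
  shows "\<exists>M :: (nat, nat) cgraph.
           maniplex n M \<and> finite_graph M \<and> isomorphic_cgraphs (STG M) X"
proof -
  obtain x0 where "x0 \<in> verts X"
    using assms(2) by (auto simp: premaniplex_def connected_graph_def graph_def)
  then interpret marking n X x0
    using assms by unfold_locales (auto simp: finite_graph_def)
  interpret marked_action n Z R X fst word base by (rule marked_action)
  show ?thesis by (rule cover_action.ex_maniplex[OF cover_action_states])
qed

end
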